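(* Let $n\ge 1$, let $a=(a_1,\dots,a_n)$ be an $n$-tuple of positive integers, $|a|=a_1+\dots+a_n$, and let $0\le m\le m'\le |a|$. Let $B=B_m^{m'}(a)$ and $$\mathcal B:=Sint(a;m)\cup Int(a;m)\cup Int(a;m+1)\cup\dots\cup Int(a;m')$$ (when $m=0$, the zero vector is also included in $\mathcal B$). Then $\mathcal B$ is a TP-basis for $B$, i.e. the restriction map $\mathcal T(B)\to\mathbb R^{\mathcal B}$, $f\mapsto f|_{\mathcal B}$, is a bijection: every TP-function on $B$ is determined by its values on $\mathcal B$, and every real function on $\mathcal B$ is the restriction of some TP-function on $B$.
   Context: For $0\le m\le m'\le|a|$, $B_m^{m'}(a):=\{x\in\mathbb Z^n: 0\le x_i\le a_i\ (i\in[n]),\ m\le x_1+\dots+x_n\le m'\}$, and $|x|:=x_1+\dots+x_n$. $1_q$ denotes the $q$-th unit vector of $\mathbb R^n$. A function $f:B\to\mathbb R$ is a TP-function (tropical Plücker function) if (TP3) $f(x+1_i+1_k)+f(x+1_j)=\max\{f(x+1_i+1_j)+f(x+1_k),\ f(x+1_i)+f(x+1_j+1_k)\}$ for every $x\in\mathbb Z^n$ and $1\le i<j<k\le n$ such that all six vectors occurring belong to $B$, and (TP4) $f(x+1_i+1_k)+f(x+1_j+1_\ell)=\max\{f(x+1_i+1_j)+f(x+1_k+1_\ell),\ f(x+1_i+1_\ell)+f(x+1_j+1_k)\}$ for every $x\in\mathbb Z^n$ and $1\le i<j<k<\ell\le n$ such that all six vectors occurring belong to $B$. $\mathcal T(B)$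 denotes the set of TP-functions on $B$. For a nonzero $x$ with $0\le x\le a$, let $c(x)$ and $d(x)$ be the smallest and largest elements of ${\rm supp}(x)=\{i:x_i\neq0\}$. $x$ is a fuzzy-interval (fint) if $x_i=a_i$ for all $c(x)<i<d(x)$. $x$ is a sesquialteral fuzzy-interval (sint) if $x$ is not a fint and $x=x'+x''$ for fints $x',x''$ with $d(x')<c(x'')$ and $x'_i=a_i$ for $i=1,\dots,d(x')-1$. $Int(a;p)$ and $Sint(a;p)$ denote the sets of fints and sints $x$ with $|x|=p$ and $0\le x\le a$. *)

theory Defs
  imports Complex_Main "HOL-Library.FuncSet" "HOL-Library.Function_Algebras"
begin

text \<open>
  A vector of \<open>\<int>\<^sup>n\<close> is a function on the naturals that vanishes outside \<open>{1..n}\<close>, so that \<open>n\<close>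
  can be an ordinary variable. Addition and the zero vector are the pointwise ones.
\<close>

type_synonym ivec = "nat \<Rightarrow> int"

definition int_vecs :: "nat \<Rightarrow> ivec set" where
  "int_vecs n = {x. \<forall>i. i \<notin> {1..n} \<longrightarrow> x i = 0}"

definition unit_vec :: "nat \<Rightarrow> ivec" where
  "unit_vec q = (\<lambda>i. if i = q then 1 else 0)"

definition vsize :: "nat \<Rightarrow> ivec \<Rightarrow> int" where
  "vsize n x = (\<Sum>i\<in>{1..n}. x i)"

text \<open>Only the values of \<open>a\<close> on \<open>{1..n}\<close> are ever used.\<close>

definition box :: "nat \<Rightarrow> ivec \<Rightarrow> ivec set" where
  "box n a = {x \<in> int_vecs n. \<forall>i\<in>{1..n}. 0 \<le> x i \<and> x i \<le> a i}"

definition truncated_box :: "nat \<Rightarrow> ivec \<Rightarrow> int \<Rightarrow> int \<Rightarrow> ivec set" where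
  "truncated_box n a m m' = {x \<in> box n a. m \<le> vsize n x \<and> vsize n x \<le> m'}"

definition TP3 :: "nat \<Rightarrow> ivec set \<Rightarrow> (ivec \<Rightarrow> real) \<Rightarrow> bool" where
  "TP3 n B f \<longleftrightarrow> (\<forall>x\<in>int_vecs n. \<forall>i j k. 1 \<le> i \<and> i < j \<and> j < k \<and> k \<le> n \<longrightarrow>
     {x + unit_vec i + unit_vec k, x + unit_vec j,
      x + unit_vec i + unit_vec j, x + unit_vec k,
      x + unit_vec i, x + unit_vec j + unit_vec k} \<subseteq> B \<longrightarrow>
     f (x + unit_vec i + unit_vec k) + f (x + unit_vec j) =
       max (f (x + unit_vec i + unit_vec j) + f (x + unit_vec k))
           (f (x + unit_vec i) + f (x + unit_vec j + unit_vec k)))"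

definition TP4 :: "nat \<Rightarrow> ivec set \<Rightarrow> (ivec \<Rightarrow> real) \<Rightarrow> bool" where
  "TP4 n B f \<longleftrightarrow> (\<forall>x\<in>int_vecs n. \<forall>i j k l. 1 \<le> i \<and> i < j \<and> j < k \<and> k < l \<and> l \<le> n \<longrightarrow>
     {x + unit_vec i + unit_vec k, x + unit_vec j + unit_vec l,
      x + unit_vec i + unit_vec j, x + unit_vec k + unit_vec l,
      x + unit_vec i + unit_vec l, x + unit_vec j + unit_vec k} \<subseteq> B \<longrightarrow>
     f (x + unit_vec i + unit_vec k) + f (x + unit_vec j + unit_vec l) =
       max (f (x + unit_vec i + unit_vec j) + f (x + unit_vec k + unit_vec l))
           (f (x + unit_vec i + unit_vec l) + f (x + unit_vec j + unit_vec k)))"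

text \<open>
  Functions with domain \<open>B\<close> are extensional (\<open>undefined\<close> off \<open>B\<close>), so that two of them are equal
  exactly when they agree on \<open>B\<close>.
\<close>

definition TP_functions :: "nat \<Rightarrow> ivec set \<Rightarrow> (ivec \<Rightarrow> real) set" where
  "TP_functions n B = {f \<in> B \<rightarrow>\<^sub>E UNIV. TP3 n B f \<and> TP4 n B f}"

definition TP_basis :: "nat \<Rightarrow> ivec set \<Rightarrow> ivec set \<Rightarrow> bool" where
  "TP_basis n B C \<longleftrightarrow>
     C \<subseteq> B \<and> bij_betw (\<lambda>f. restrict f C) (TP_functions n B) (C \<rightarrow>\<^sub>E (UNIV :: real set))"

definition vsupp :: "nat \<Rightarrow> ivec \<Rightarrow> nat set" where
  "vsupp n x = {i \<in> {1..n}. x i \<noteq> 0}"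

definition cmin :: "nat \<Rightarrow> ivec \<Rightarrow> nat" where
  "cmin n x = Min (vsupp n x)"

definition dmax :: "nat \<Rightarrow> ivec \<Rightarrow> nat" where
  "dmax n x = Max (vsupp n x)"

definition fint :: "nat \<Rightarrow> ivec \<Rightarrow> ivec \<Rightarrow> bool" where
  "fint n a x \<longleftrightarrow> x \<in> box n a \<and> x \<noteq> 0 \<and> (\<forall>i. cmin n x < i \<and> i < dmax n x \<longrightarrow> x i = a i)"

definition sint :: "nat \<Rightarrow> ivec \<Rightarrow> ivec \<Rightarrow> bool" where
  "sint n a x \<longleftrightarrow> x \<in> box n a \<and> x \<noteq> 0 \<and> \<not> fint n a x \<and>
     (\<exists>x' x''. fint n a x' \<and> fint n a x'' \<and> x = x' + x'' \<and> dmax n x' < cmin n x'' \<and>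
        (\<forall>i. 1 \<le> i \<and> i < dmax n x' \<longrightarrow> x' i = a i))"

definition Fints :: "nat \<Rightarrow> ivec \<Rightarrow> int \<Rightarrow> ivec set" where
  "Fints n a p = {x. fint n a x \<and> vsize n x = p}"

definition Sints :: "nat \<Rightarrow> ivec \<Rightarrow> int \<Rightarrow> ivec set" where
  "Sints n a p = {x. sint n a x \<and> vsize n x = p}"

definition std_basis :: "nat \<Rightarrow> ivec \<Rightarrow> int \<Rightarrow> int \<Rightarrow> ivec set" where
  "std_basis n a m m' =
     Sints n a m \<union> (\<Union>p\<in>{m..m'}. Fints n a p) \<union> (if m = 0 then {0} else {})"

end

theory Submission
  imports "Jordan_Normal_Form.Determinant" Defs
begin

text \<open>
  Give each \<open>x\<close> in \<open>B\<close> an extra coordinate \<open>x\<^sub>0 = m' - |x|\<close>, bounded by \<open>m' - m\<close>. All vectors then have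
  size \<open>m'\<close>, and (TP3) becomes the case \<open>i = 0\<close> of (TP4), which is invariant under cyclic shifts of
  the indices. The basis turns into the set of \<open>x\<close> without a pattern \<open>i < c < k < d\<close> such that \<open>x\<^sub>i\<close>, \<open>x\<^sub>k\<close>
  are not maximal and \<open>x\<^sub>c\<close>, \<open>x\<^sub>d\<close> are not zero. Such a pattern expresses the value at \<open>x\<close> by values at
  vectors that are smaller in a suitable well-founded order; this gives uniqueness.

  For existence, the analogue over the positive reals, with \<open>(+, *)\<close> in place of \<open>(max, +)\<close>, is solved by
  the maximal minors of a matrix with \<open>m'\<close> rows whose columns are chosen one after another: the
  basis values that involve a given last column form a triangular linear system for its entries.
  Applying this to the values \<open>exp (p * g x)\<close>, taking logarithms and dividing by \<open>p\<close>, the tropical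
  function is obtained in the limit \<open>p \<rightarrow> \<infinity>\<close>.
\<close>

section \<open>Determinants of lists of columns\<close>

text \<open>Columns are functions on all naturals and the list length fixes the number of rows, so
  lists can be split, permuted and extended without bookkeeping of dimensions.\<close>

definition ldet :: "(nat \<Rightarrow> real) list \<Rightarrow> real" where
  "ldet vs = det (mat (length vs) (length vs) (\<lambda>(r, t). (vs ! t) r))"

definition basis_col :: "nat \<Rightarrow> nat \<Rightarrow> real" where
  "basis_col q = (\<lambda>r. if r = q then 1 else 0)"

lemma ldet_basis_col: "ldet (map basis_col [0..<M]) = 1"
proof -
  have "mat (length (map basis_col [0..<M])) (length (map basis_col [0..<M]))
      (\<lambda>(r, t). (map basis_col [0..<M] ! t) r) = 1\<^sub>m M"
    by (rule eq_matI) (auto simp: basis_col_def)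
  then show ?thesis unfolding ldet_def by simp
qed

lemma ldet_swap: "ldet (xs @ u # v # ys) = - ldet (xs @ v # u # ys)"
proof -
  let ?k = "length xs" and ?n = "length xs + length ys + 2"
  let ?A = "mat ?n ?n (\<lambda>(r, t). ((xs @ v # u # ys) ! t) r)"
  have "swapcols ?k (Suc ?k) ?A = mat ?n ?n (\<lambda>(r, t). ((xs @ u # v # ys) ! t) r)"
    by (rule eq_matI) (auto simp: nth_append nth_Cons split: nat.splits)
  moreover have "det (swapcols ?k (Suc ?k) ?A) = - det ?A"
    by (rule det_swapcols[of _ ?n]) auto
  ultimately show ?thesis unfolding ldet_def by simp
qed

lemma ldet_dup: "ldet (xs @ u # ys @ u # zs) = 0"
proof -
  let ?vs = "xs @ u # ys @ u # zs"
  let ?A = "mat (length ?vs) (length ?vs) (\<lambda>(r, t). (?vs ! t) r)"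
  have "col ?A (length xs) = col ?A (length xs + length ys + 1)"
    by (rule eq_vecI) (auto simp: nth_append)
  then show ?thesis unfolding ldet_def
    by (intro det_identical_columns[of ?A "length ?vs" "length xs" "length xs + length ys + 1"]) auto
qed

text \<open>Laplace expansion along the last column: its cofactors do not see that column, and
  inserting \<open>basis_col r\<close> there singles out the cofactor at row
  \<open>r\<close>.\<close>

lemma ldet_expand_last:
  "ldet (ys @ [v]) = (\<Sum>r\<le>length ys. v r * ldet (ys @ [basis_col r]))"
proof -
  let ?n = "Suc (length ys)"
  define A where "A v = mat ?n ?n (\<lambda>(r, t). ((ys @ [v]) ! t) r)" for v :: "nat \<Rightarrow> real"
  \<comment> \<open>The last column is irrelevant for these cofactors; the zero column serves as a
    fixed representative.\<close>
  define c where "c r = cofactor (A (\<lambda>_. 0)) r (length ys)" for r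
  have c: "cofactor (A v) r (length ys) = c r" if "r < ?n" for v r
  proof -
    have "mat_delete (A v) r (length ys) = mat_delete (A (\<lambda>_. 0)) r (length ys)"
      by (rule eq_matI) (auto simp: mat_delete_def A_def nth_append)
    then show ?thesis by (simp add: c_def cofactor_def)
  qed
  have *: "ldet (ys @ [v]) = (\<Sum>r<?n. v r * c r)" for v
  proof -
    have "ldet (ys @ [v]) = det (A v)" by (simp add: ldet_def A_def)
    also have "\<dots> = (\<Sum>r<?n. A v $$ (r, length ys) * cofactor (A v) r (length ys))"
      by (rule laplace_expansion_column) (auto simp: A_def)
    also have "\<dots> = (\<Sum>r<?n. v r * c r)"
      by (intro sum.cong refl) (auto simp: c, auto simp: A_def)
    finally show ?thesis .
  qed
  have "ldet (ys @ [basis_col r]) = c r" if "r \<le> length ys" for r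
    unfolding * using that by (simp add: basis_col_def of_bool_def[symmetric] if_distrib cong: if_cong)
  then show ?thesis unfolding * by (simp add: lessThan_Suc_atMost)
qed

text \<open>Laplace expansion of a determinant in which row \<open>r\<close> occurs twice.\<close>

lemma ldet_omit_sum:
  assumes "length ws = Suc M" "r < M"
  shows "(\<Sum>t\<le>M. (-1) ^ t * (ws ! t) r * ldet (take t ws @ drop (Suc t) ws)) = 0"
proof -
  let ?n = "Suc M"
  define B where "B = mat ?n ?n (\<lambda>(s, t). (ws ! t) (case s of 0 \<Rightarrow> r | Suc s \<Rightarrow> s))"
  have B: "B \<in> carrier_mat ?n ?n" by (simp add: B_def)
  have "det B = 0"
    by (rule det_identical_rows[of _ ?n 0 "Suc r"]) (use assms in \<open>auto simp: B_def intro!: eq_vecI\<close>)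
  moreover have "det B = (\<Sum>t<?n. B $$ (0, t) * cofactor B 0 t)"
    by (rule laplace_expansion_row[OF B]) simp
  moreover have "B $$ (0, t) * cofactor B 0 t =
      (-1) ^ t * (ws ! t) r * ldet (take t ws @ drop (Suc t) ws)" if "t < ?n" for t
  proof -
    have "mat_delete B 0 t = mat M M (\<lambda>(s, j). ((take t ws @ drop (Suc t) ws) ! j) s)"
      using that assms by (intro eq_matI) (auto simp: mat_delete_def B_def nth_append)
    then show ?thesis using that assms by (simp add: cofactor_def ldet_def B_def)
  qed
  ultimately show ?thesis by (simp add: lessThan_Suc_atMost)
qed

text \<open>\<open>ldet (xs @ [l, v])\<close> is a linear form in \<open>v\<close>. Combining the
  relations of \<open>ldet_omit_sum\<close> over all rows with the coefficients of this form
  replaces the entry \<open>(ws ! t) r\<close> by a determinant, which vanishes by repetition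
  whenever \<open>ws ! t\<close> belongs to \<open>xs\<close>.\<close>

lemma ldet_pluecker:
  "ldet (xs @ [i, k]) * ldet (xs @ [j, l]) =
   ldet (xs @ [i, j]) * ldet (xs @ [k, l]) + ldet (xs @ [i, l]) * ldet (xs @ [j, k])"
proof -
  let ?M = "length xs + 2"
  let ?ws = "xs @ [i, j, k]"
  let ?d = "\<lambda>t. ldet (take t ?ws @ drop (Suc t) ?ws)"
  let ?w = "\<lambda>v. ldet (xs @ [l, v])"
  have lin: "?w v = (\<Sum>r<?M. v r * ?w (basis_col r))" for v
    using ldet_expand_last[of "xs @ [l]" v] by (simp add: lessThan_Suc_atMost)
  have "(\<Sum>t\<le>?M. (-1) ^ t * ?w (?ws ! t) * ?d t) =
      (\<Sum>t\<le>?M. \<Sum>r<?M. ?w (basis_col r) * ((-1) ^ t * (?ws ! t) r * ?d t))"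
    by (subst lin) (unfold sum_distrib_left sum_distrib_right, intro sum.cong refl, simp only: mult_ac)
  also have "\<dots> = (\<Sum>r<?M. ?w (basis_col r) * (\<Sum>t\<le>?M. (-1) ^ t * (?ws ! t) r * ?d t))"
    by (subst sum.swap) (simp only: sum_distrib_left)
  also have "\<dots> = 0"
    by (intro sum.neutral ballI, subst ldet_omit_sum[of ?ws ?M]) auto
  finally have 0: "(\<Sum>t\<le>?M. (-1) ^ t * ?w (?ws ! t) * ?d t) = 0" .
  have "?w (?ws ! t) = 0" if "t < length xs" for t
  proof -
    have "xs = take t xs @ xs ! t # drop (Suc t) xs" using that by (simp add: id_take_nth_drop)
    then have "xs @ [l, xs ! t] = take t xs @ xs ! t # (drop (Suc t) xs @ [l]) @ xs ! t # []"
      by (metis append.assoc append_Cons append_Nil)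
    then show ?thesis using that by (metis ldet_dup nth_append_left)
  qed
  then have "(\<Sum>t<length xs. (-1) ^ t * ?w (?ws ! t) * ?d t) = 0"
    by (intro sum.neutral) auto
  \<comment> \<open>Only the last three positions survive; they omit \<open>i\<close>,
    \<open>j\<close>, \<open>k\<close> in turn, with alternating signs.\<close>
  then have "?w i * ldet (xs @ [j, k]) - ?w j * ldet (xs @ [i, k]) + ?w k * ldet (xs @ [i, j]) = 0"
    using 0 by (simp add: lessThan_Suc_atMost[symmetric] nth_append algebra_simps
        flip: distrib_left)
  moreover have "?w v = - ldet (xs @ [v, l])" for v using ldet_swap[of xs l v "[]"] by simp
  ultimately show ?thesis by (simp add: algebra_simps)
qed

lemma ldet_move_last: "ldet (xs @ u # ys) = (-1) ^ length ys * ldet (xs @ ys @ [u])"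
proof (induction ys arbitrary: xs)
  case (Cons y ys)
  show ?case using Cons[of "xs @ [y]"] ldet_swap[of xs u y ys] by simp
qed simp

text \<open>Moving two columns to the end costs a sign given by the number of columns between them.
  In each of the three products the signs multiply to the parity of
  \<open>length B + length D\<close>, so the relation reduces to
  \<open>ldet_pluecker\<close>.\<close>

lemma ldet_pluecker_spread:
  "ldet (A @ i # B @ C @ k # D @ E) * ldet (A @ B @ j # C @ D @ l # E) =
   ldet (A @ i # B @ j # C @ D @ E) * ldet (A @ B @ C @ k # D @ l # E) +
   ldet (A @ i # B @ C @ D @ l # E) * ldet (A @ B @ j # C @ k # D @ E)"
proof -
  let ?X = "A @ B @ C @ D @ E"
  have two: "ldet (P @ u # Q @ v # R) = (-1) ^ length Q * ldet (P @ Q @ R @ [u, v])" for P Q R u v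
  proof -
    have "ldet (P @ u # Q @ v # R) = (-1) ^ length R * ldet (P @ u # Q @ R @ [v])"
      using ldet_move_last[of "P @ u # Q" v R] by simp
    also have "ldet (P @ u # Q @ R @ [v]) = (-1) ^ (length Q + length R + 1) * ldet (P @ Q @ R @ [v, u])"
      using ldet_move_last[of P u "Q @ R @ [v]"] by simp
    also have "ldet (P @ Q @ R @ [v, u]) = - ldet (P @ Q @ R @ [u, v])"
      using ldet_swap[of "P @ Q @ R" v u "[]"] by simp
    finally show ?thesis by (simp add: power_add)
  qed
  show ?thesis
    using two[of A i "B @ C" k "D @ E"] two[of "A @ B" j "C @ D" l E]
      two[of A i B j "C @ D @ E"] two[of "A @ B @ C" k D l E]
      two[of A i "B @ C @ D" l E] two[of "A @ B" j C k "D @ E"]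
      ldet_pluecker[of ?X i k j l]
    by (simp add: power_add algebra_simps)
qed

section \<open>Slices of boxes\<close>

definition nunit :: "nat \<Rightarrow> nat \<Rightarrow> nat" where
  "nunit q = (\<lambda>i. if i = q then 1 else 0)"

text \<open>Index 0 is included: it is the place of the extra coordinate.\<close>

definition slice :: "nat \<Rightarrow> (nat \<Rightarrow> nat) \<Rightarrow> nat \<Rightarrow> (nat \<Rightarrow> nat) set" where
  "slice n b M = {x. (\<forall>t>n. x t = 0) \<and> (\<forall>t\<le>n. x t \<le> b t) \<and> sum x {..n} = M}"

definition gap_free :: "nat \<Rightarrow> (nat \<Rightarrow> nat) \<Rightarrow> (nat \<Rightarrow> nat) \<Rightarrow> bool" where
  "gap_free n b x \<longleftrightarrow>
     \<not> (\<exists>i c k d. i < c \<and> c < k \<and> k < d \<and> d \<le> n \<and> x i < b i \<and> 0 < x c \<and> x k < b k \<and> 0 < x d)"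

definition quad :: "(nat \<Rightarrow> nat) \<Rightarrow> nat \<Rightarrow> nat \<Rightarrow> nat \<Rightarrow> nat \<Rightarrow> (nat \<Rightarrow> nat) set" where
  "quad z i j k l =
     {z + nunit i + nunit k, z + nunit j + nunit l,
      z + nunit i + nunit j, z + nunit k + nunit l,
      z + nunit i + nunit l, z + nunit j + nunit k}"

text \<open>
  Think of a vector \<open>x\<close> as the set consisting of the first \<open>x t\<close> columns of block \<open>t\<close>, where block \<open>t\<close> has
  \<open>b t\<close> columns. Then \<open>prefix_len\<close> counts the columns before the first missing one, and \<open>last_pos\<close> those
  up to the last one present.
\<close>

definition prefix_len :: "nat \<Rightarrow> (nat \<Rightarrow> nat) \<Rightarrow> (nat \<Rightarrow> nat) \<Rightarrow> nat" where
  "prefix_len n b x = (\<Sum>t\<le>n. if \<forall>s<t. x s = b s then x t else 0)"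

definition last_pos :: "nat \<Rightarrow> (nat \<Rightarrow> nat) \<Rightarrow> (nat \<Rightarrow> nat) \<Rightarrow> nat" where
  "last_pos n b x = (\<Sum>t\<le>n. if \<exists>s>t. s \<le> n \<and> 0 < x s then b t else x t)"

lemma sum_nunit: "i \<le> n \<Longrightarrow> (\<Sum>t\<le>n. f t * nunit i t) = f i" for f :: "nat \<Rightarrow> nat"
  by (simp add: nunit_def if_distrib cong: if_cong)

lemma sum_add_nunit: "i \<le> n \<Longrightarrow> sum (x + nunit i) {..n} = Suc (sum x {..n})"
  using sum_nunit[of i n "\<lambda>_. 1"] by (simp add: sum.distrib)

text \<open>There is room for a unit at \<open>i\<close> and \<open>k\<close> by assumption, and at
  \<open>c\<close> and \<open>d\<close> because the given vector lies in the slice. Hence any two of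
  the four units can be added.\<close>

lemma quad_subset_slice:
  assumes z: "z + nunit c + nunit d \<in> slice n b M"
    and "i < c" "c < k" "k < d" "d \<le> n" "z i < b i" "z k < b k"
  shows "quad z i c k d \<subseteq> slice n b M"
proof -
  have zero: "z t = 0" if "t > n" for t
    using z that assms(2-5) by (auto simp: slice_def)
  have le: "z t + nunit c t + nunit d t \<le> b t" if "t \<le> n" for t
    using z that by (simp add: slice_def)
  then have le': "z t \<le> b t" if "t \<le> n" for t using that by (meson add_leD1)
  have room: "z c < b c" "z d < b d"
    using le[of c] le[of d] assms(2-5) by (auto simp: nunit_def)
  have sum: "Suc (Suc (sum z {..n})) = M"
    using z assms(2-5) by (simp add: slice_def sum_add_nunit del: plus_fun_apply)
  have add: "z + nunit p + nunit q \<in> slice n b M"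
    if "p \<le> n" "q \<le> n" "p \<noteq> q" "z p < b p" "z q < b q" for p q
  proof -
    have "sum (z + nunit p + nunit q) {..n} = M"
      using that(1,2) sum by (simp add: sum_add_nunit del: plus_fun_apply)
    moreover have "(z + nunit p + nunit q) t = 0" if "t > n" for t
      using that zero \<open>p \<le> n\<close> \<open>q \<le> n\<close> by (simp add: nunit_def)
    moreover have "(z + nunit p + nunit q) t \<le> b t" if "t \<le> n" for t
      using le'[OF that] \<open>p \<noteq> q\<close> \<open>z p < b p\<close> \<open>z q < b q\<close> by (simp add: nunit_def)
    ultimately show ?thesis by (simp add: slice_def del: plus_fun_apply)
  qed
  show ?thesis
    unfolding quad_def insert_subset by (intro conjI add empty_subsetI) (use assms room in auto)
qed

section \<open>Extremal positions and induction over a slice\<close>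

definition is_prefix :: "nat \<Rightarrow> (nat \<Rightarrow> nat) \<Rightarrow> (nat \<Rightarrow> nat) \<Rightarrow> bool" where
  "is_prefix n b x \<longleftrightarrow> (\<forall>t s. t < s \<longrightarrow> s \<le> n \<longrightarrow> x t < b t \<longrightarrow> x s = 0)"

text \<open>Takes the first block that is not full and the last one that is not empty. A witness
  against being a prefix lies between them, which gives \<open>i < d\<close>.\<close>

lemma slice_ends:
  assumes x: "x \<in> slice n b M" and "\<not> is_prefix n b x"
  obtains i d where "i < d" "d \<le> n" "x i < b i" "\<And>s. s < i \<Longrightarrow> x s = b s"
    "0 < x d" "\<And>t. t > d \<Longrightarrow> x t = 0"
proof -
  from assms obtain i0 d0 where 0: "i0 < d0" "d0 \<le> n" "x i0 < b i0" "0 < x d0"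
    by (auto simp: is_prefix_def)
  define i where "i = (LEAST i. x i < b i)"
  define d where "d = (GREATEST d. d \<le> n \<and> 0 < x d)"
  have i: "x i < b i" "i \<le> i0" and i_min: "\<And>s. s < i \<Longrightarrow> \<not> x s < b s"
    unfolding i_def using 0 by (auto intro: LeastI Least_le dest: not_less_Least)
  have d: "d \<le> n \<and> 0 < x d" unfolding d_def
    by (rule GreatestI_nat[of _ d0 n]) (use 0 in auto)
  have d_max: "s \<le> d" if "s \<le> n" "0 < x s" for s unfolding d_def
    by (rule Greatest_le_nat[of _ _ n]) (use that in auto)
  show thesis
  proof (rule that[of i d])
    show "i < d" using i d_max[of d0] 0 by auto
    show "x s = b s" if "s < i" for s
      using i_min[OF that] x that \<open>i < d\<close> d by (auto simp: slice_def intro: le_antisym)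
    show "x s = 0" if "s > d" for s
      using d_max[of s] x that by (cases "s \<le> n") (auto simp: slice_def)
  qed (use i d in auto)
qed

text \<open>Blocks before \<open>d\<close> count in full for \<open>x\<close>, so \<open>y\<close>
  cannot exceed them, and nothing lies beyond \<open>d\<close>; block \<open>d\<close> itself makes
  the inequality strict.\<close>

lemma last_pos_less:
  assumes y: "y \<in> slice n b M" and d: "d \<le> n" "y d < x d"
    and zero: "\<And>t. t > d \<Longrightarrow> x t = 0" "\<And>t. t > d \<Longrightarrow> y t = 0"
  shows "last_pos n b y < last_pos n b x"
  unfolding last_pos_def
proof (rule sum_strict_mono_ex1)
  have late: "(if \<exists>s>t. s \<le> n \<and> 0 < f s then b t else f t) = f t"
    if "t \<ge> d" "\<And>t. t > d \<Longrightarrow> f t = 0" for t f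
  proof -
    have "\<not> (\<exists>s>t. s \<le> n \<and> 0 < f s)" using that by auto
    then show ?thesis by (simp only: if_False)
  qed
  have late_xy: "(if \<exists>s>t. s \<le> n \<and> 0 < x s then b t else x t) = x t"
    "(if \<exists>s>t. s \<le> n \<and> 0 < y s then b t else y t) = y t" if "t \<ge> d" for t
    by (rule late[OF that], erule zero)+
  show "\<forall>t\<in>{..n}. (if \<exists>s>t. s \<le> n \<and> 0 < y s then b t else y t)
      \<le> (if \<exists>s>t. s \<le> n \<and> 0 < x s then b t else x t)"
  proof
    fix t assume "t \<in> {..n}"
    then have "t \<le> n" by simp
    consider "t < d" | "t = d" | "t > d" by linarith
    then show "(if \<exists>s>t. s \<le> n \<and> 0 < y s then b t else y t)
      \<le> (if \<exists>s>t. s \<le> n \<and> 0 < x s then b t else x t)"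
    proof cases
      case 1
      then have "\<exists>s>t. s \<le> n \<and> 0 < x s" using d by auto
      then show ?thesis using y \<open>t \<le> n\<close> by (simp add: slice_def)
    next
      case 2
      then show ?thesis using d by (simp only: late_xy order_refl less_imp_le)
    next
      case 3
      then have "d \<le> t" by simp
      show ?thesis unfolding late_xy[OF \<open>d \<le> t\<close>] using 3 zero by simp
    qed
  qed
  show "\<exists>t\<in>{..n}. (if \<exists>s>t. s \<le> n \<and> 0 < y s then b t else y t)
      < (if \<exists>s>t. s \<le> n \<and> 0 < x s then b t else x t)"
    by (rule bexI[of _ d]) (use d in \<open>simp_all only: late_xy order_refl atMost_iff\<close>)
qed simp

text \<open>
  The induction step uses the pattern whose \<open>i\<close> is least and whose \<open>d\<close> is greatest. Of the other five
  vectors, the three that lost a unit at \<open>d\<close> have their last column earlier; \<open>z + nunit i + nunit d\<close> has a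
  longer prefix; and in \<open>z + nunit k + nunit d\<close> a unit moved right without affecting either.
\<close>

lemma slice_induct [consumes 1, case_names base step]:
  assumes "x \<in> slice n b M"
    and base: "\<And>x. x \<in> slice n b M \<Longrightarrow> gap_free n b x \<Longrightarrow> P x"
    and step: "\<And>z i c k d. i < c \<Longrightarrow> c < k \<Longrightarrow> k < d \<Longrightarrow> d \<le> n \<Longrightarrow> quad z i c k d \<subseteq> slice n b M \<Longrightarrow>
      (\<And>y. y \<in> quad z i c k d \<Longrightarrow> y \<noteq> z + nunit c + nunit d \<Longrightarrow> P y) \<Longrightarrow> P (z + nunit c + nunit d)"
  shows "P x"
proof -
  define w where "w x = (\<Sum>t\<le>n. t * x t)" for x :: "nat \<Rightarrow> nat"
  \<comment> \<open>Lexicographic order. The prefix length is at most \<open>M\<close> and the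
    weight \<open>w\<close> at most \<open>n * M\<close> on the slice, so subtracting from these
    bounds turns their growth into descent.\<close>
  define r where "r = measures [last_pos n b, \<lambda>x. M - prefix_len n b x, \<lambda>x. n * M - w x]"
  have "x \<in> slice n b M \<longrightarrow> P x"
  proof (induction x rule: wf_induct[where r = r])
    case 1
    show ?case unfolding r_def by simp
  next
    case (2 x)
    show ?case
    proof (intro impI, cases "gap_free n b x")
      case False
      assume x: "x \<in> slice n b M"
      from False obtain i0 c k d0 where pat: "i0 < c" "c < k" "k < d0" "d0 \<le> n"
        "x i0 < b i0" "0 < x c" "x k < b k" "0 < x d0"
        unfolding gap_free_def by blast
      then have "i0 < d0" by simp
      then have "\<not> is_prefix n b x" using pat(4,5,8) unfolding is_prefix_def by (metis less_irrefl)
      with x obtain i d where "i < d" and dn: "d \<le> n" and i: "x i < b i"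
        and full: "\<And>s. s < i \<Longrightarrow> x s = b s" and d0: "0 < x d" and zero: "\<And>s. s > d \<Longrightarrow> x s = 0"
        by (rule slice_ends) (rule that)
      note d = conjI[OF dn d0]
      \<comment> \<open>The outer indices of the pattern can be pushed out to the extremal ones:
        everything before \<open>i\<close> is full and everything after \<open>d\<close> is
        empty.\<close>
      have "\<not> i0 < i" "\<not> d < d0" using full[of i0] zero[of d0] pat by auto
      then have ord: "i < c" "c < k" "k < d" using pat by auto
      define z where "z = (\<lambda>t. x t - nunit c t - nunit d t)"
      have xz: "x = z + nunit c + nunit d"
        using pat d ord by (auto simp: z_def nunit_def)
      have quad: "quad z i c k d \<subseteq> slice n b M"
      proof (rule quad_subset_slice)
        show "z + nunit c + nunit d \<in> slice n b M" using x xz by simp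
        have "z t \<le> x t" for t by (simp add: z_def)
        then show "z i < b i" "z k < b k" using i pat le_less_trans by blast+
      qed (use ord d in auto)
      have xd: "x d = Suc (z d)" and xt: "\<And>t. t \<noteq> c \<Longrightarrow> t \<noteq> d \<Longrightarrow> z t = x t"
        using ord by (auto simp: xz nunit_def)
      have dec1: "last_pos n b y < last_pos n b x"
        if y: "y \<in> slice n b M" and "y d = z d" "\<And>t. t > d \<Longrightarrow> y t = 0" for y
        by (rule last_pos_less[OF y, of d]) (use that d xd zero in auto)
      have same1: "last_pos n b y = last_pos n b x"
        if "y d = x d" "\<And>t. t > d \<Longrightarrow> y t = x t" for y
        unfolding last_pos_def
      proof (rule sum.cong[OF refl])
        fix t assume "t \<in> {..n}"
        show "(if \<exists>s>t. s \<le> n \<and> 0 < y s then b t else y t)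
            = (if \<exists>s>t. s \<le> n \<and> 0 < x s then b t else x t)"
        proof (cases "t < d")
          case True
          then have "\<exists>s>t. s \<le> n \<and> 0 < x s" "\<exists>s>t. s \<le> n \<and> 0 < y s" using d that by auto
          then show ?thesis by simp
        next
          case False
          then show ?thesis using that by (cases "t = d") auto
        qed
      qed
      have dec2: "M - prefix_len n b y < M - prefix_len n b x"
        if y: "y \<in> slice n b M" and "y i = Suc (x i)" "\<And>t. t < i \<Longrightarrow> y t = x t" for y
      proof -
        have "prefix_len n b x < prefix_len n b y" unfolding prefix_len_def
        proof (rule sum_strict_mono_ex1)
          show "\<forall>t\<in>{..n}. (if \<forall>s<t. x s = b s then x t else 0) \<le> (if \<forall>s<t. y s = b s then y t else 0)"
          proof
            fix t assume "t \<in> {..n}"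
            show "(if \<forall>s<t. x s = b s then x t else 0) \<le> (if \<forall>s<t. y s = b s then y t else 0)"
            proof (cases "t > i")
              case True
              then have "\<not> (\<forall>s<t. x s = b s)" using i by auto
              then show ?thesis by (simp only: if_False le0)
            next
              case False
              then have eq: "(\<forall>s<t. y s = b s) = (\<forall>s<t. x s = b s)" using that(3) by auto
              show ?thesis unfolding eq using that False by (cases "t = i") auto
            qed
          qed
          show "\<exists>t\<in>{..n}. (if \<forall>s<t. x s = b s then x t else 0) < (if \<forall>s<t. y s = b s then y t else 0)"
            using that full ord d by (intro bexI[of _ i]) auto
        qed simp
        moreover have "prefix_len n b y \<le> M"
        proof -
          have "prefix_len n b y \<le> sum y {..n}"
            unfolding prefix_len_def by (rule sum_mono) auto
          then show ?thesis using y by (simp add: slice_def)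
        qed
        ultimately show ?thesis by linarith
      qed
      have same2: "prefix_len n b y = prefix_len n b x"
        if "\<And>t. t \<le> i \<Longrightarrow> y t = x t" for y
        unfolding prefix_len_def
      proof (rule sum.cong[OF refl])
        fix t
        show "(if \<forall>s<t. y s = b s then y t else 0) = (if \<forall>s<t. x s = b s then x t else 0)"
        proof (cases "t > i")
          case True
          then have "\<not> (\<forall>s<t. x s = b s)" "\<not> (\<forall>s<t. y s = b s)" using i that[of i] by auto
          then show ?thesis by (simp only: if_False)
        qed (use that in auto)
      qed
      have lin: "w (y + nunit t) = w y + t" if "t \<le> n" for y t
        using sum_nunit[OF that, of id] by (simp add: w_def distrib_left sum.distrib)
      have *: "w y \<le> n * M" if "y \<in> slice n b M" for y
      proof -
        have "w y \<le> (\<Sum>t\<le>n. n * y t)" unfolding w_def by (rule sum_mono) auto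
        also have "\<dots> = n * M" using that by (simp add: slice_def flip: sum_distrib_left)
        finally show ?thesis .
      qed
      have dec3: "n * M - w (z + nunit k + nunit d) < n * M - w x"
      proof -
        have "w (z + nunit k + nunit d) = w z + k + d" "w x = w z + c + d"
          using ord d by (simp_all add: lin xz del: plus_fun_apply)
        moreover have "w (z + nunit k + nunit d) \<le> n * M"
          using quad by (intro *) (simp add: quad_def)
        ultimately show ?thesis using ord by linarith
      qed
      have less: "(y, x) \<in> r" if y: "y \<in> quad z i c k d" and ne: "y \<noteq> x" for y
      proof -
        have ys: "y \<in> slice n b M" using y quad by blast
        have z0: "z t = 0" if "t > d" for t using zero[OF that] xz by (simp add: nunit_def)
        consider "y = z + nunit i + nunit k" | "y = z + nunit i + nunit c" | "y = z + nunit c + nunit k"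
          | "y = z + nunit i + nunit d" | "y = z + nunit k + nunit d"
          using y ne by (auto simp: quad_def xz)
        then show ?thesis
        proof cases
          case 4
          have "last_pos n b y = last_pos n b x"
            by (rule same1) (use 4 ord xd xt in \<open>auto simp: nunit_def\<close>)
          moreover have "M - prefix_len n b y < M - prefix_len n b x"
            by (rule dec2[OF ys]) (use 4 ord xt in \<open>auto simp: nunit_def\<close>)
          ultimately show ?thesis by (simp add: r_def)
        next
          case 5
          have "last_pos n b y = last_pos n b x"
            by (rule same1) (use 5 ord xd xt in \<open>auto simp: nunit_def\<close>)
          moreover have "prefix_len n b y = prefix_len n b x"
            by (rule same2) (use 5 ord xt in \<open>auto simp: nunit_def\<close>)
          ultimately show ?thesis using dec3 5 by (simp add: r_def)
        qed (use dec1[OF ys] ord z0 in \<open>auto simp: r_def nunit_def\<close>)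
      qed
      have "P y" if "y \<in> quad z i c k d" "y \<noteq> z + nunit c + nunit d" for y
        using 2 less[OF that(1)] that quad by (auto simp: xz)
      then show "P x" unfolding xz using ord d quad by (intro step) auto
    qed (use base in auto)
  qed
  then show ?thesis using assms(1) by simp
qed

section \<open>Minors with prescribed values\<close>

definition col_start :: "(nat \<Rightarrow> nat) \<Rightarrow> nat \<Rightarrow> nat" where
  "col_start b t = sum b {..<t}"

text \<open>The set of columns represented by \<open>x\<close>, in increasing order and restricted
  to the blocks \<open>s..<t\<close>, so that it can be cut at block boundaries.\<close>

definition columns :: "(nat \<Rightarrow> nat) \<Rightarrow> (nat \<Rightarrow> nat) \<Rightarrow> nat \<Rightarrow> nat \<Rightarrow> nat list" where
  "columns b x s t = concat (map (\<lambda>r. [col_start b r..<col_start b r + x r]) [s..<t])"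

lemma col_start_mono: "s \<le> t \<Longrightarrow> col_start b s \<le> col_start b t"
  unfolding col_start_def by (rule sum_mono2) auto

lemma col_start_Suc: "col_start b (Suc t) = col_start b t + b t"
  by (simp add: col_start_def)

lemma col_start_less: "s < t \<Longrightarrow> c \<le> b s \<Longrightarrow> col_start b s + c \<le> col_start b t"
  using col_start_mono[of "Suc s" t b] by (simp add: col_start_Suc)

lemma upt_glue: "i \<le> j \<Longrightarrow> j \<le> k \<Longrightarrow> [i..<j] @ [j..<k] = [i..<k]"
  by (metis le_Suc_ex upt_add_eq_append)

lemma columns_split: "s \<le> t \<Longrightarrow> t \<le> u \<Longrightarrow> columns b x s u = columns b x s t @ columns b x t u"
  unfolding columns_def by (simp flip: map_append concat_append add: upt_glue)

lemma columns_cong: "(\<And>r. s \<le> r \<Longrightarrow> r < t \<Longrightarrow> x r = y r) \<Longrightarrow> columns b x s t = columns b y s t"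
  unfolding columns_def by (intro arg_cong[where f = concat] map_cong) auto

lemma columns_nunit_Suc: "s \<le> i \<Longrightarrow> columns b (x + nunit i) s (Suc i) = columns b x s (Suc i) @ [col_start b i + x i]"
  using columns_cong[of s i "x + nunit i" x b]
  by (simp add: columns_split[of s i "Suc i"]) (simp add: columns_def nunit_def)

lemma columns_nunit:
  assumes "i \<le> n"
  shows "columns b (x + nunit i) 0 (Suc n) =
    columns b x 0 (Suc i) @ (col_start b i + x i) # columns b x (Suc i) (Suc n)"
  using columns_cong[of "Suc i" "Suc n" "x + nunit i" x b] assms
  by (simp add: columns_split[of 0 "Suc i" "Suc n"] columns_nunit_Suc del: plus_fun_apply) (simp add: nunit_def)

lemma columns_nunit2:
  assumes "i < k" "k \<le> n"
  shows "columns b (x + nunit i + nunit k) 0 (Suc n) =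
    columns b x 0 (Suc i) @ (col_start b i + x i) # columns b x (Suc i) (Suc k) @
      (col_start b k + x k) # columns b x (Suc k) (Suc n)"
proof -
  have "columns b (x + nunit i) 0 (Suc k) =
      columns b x 0 (Suc i) @ (col_start b i + x i) # columns b x (Suc i) (Suc k)"
    using assms by (intro columns_nunit) simp
  moreover have "columns b (x + nunit i) (Suc k) (Suc n) = columns b x (Suc k) (Suc n)"
    using assms by (intro columns_cong) (auto simp: nunit_def)
  moreover have "(x + nunit i) k = x k" using assms by (simp add: nunit_def)
  ultimately show ?thesis using columns_nunit[OF assms(2), of b "x + nunit i"] by simp
qed

lemma length_columns: "length (columns b x 0 (Suc n)) = sum x {..n}"
  by (simp add: columns_def length_concat comp_def interv_sum_list_conv_sum_set_nat
      atLeast0LessThan lessThan_Suc_atMost del: upt_Suc)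

lemma in_columnsE:
  assumes "c \<in> set (columns b x 0 (Suc n))"
  obtains r where "r \<le> n" "c < col_start b r + x r" "col_start b r \<le> c"
proof -
  have "c \<in> (\<Union>r\<in>{0..<Suc n}. {col_start b r..<col_start b r + x r})"
    using assms by (simp add: columns_def del: upt_Suc)
  then obtain r where "r \<in> {0..<Suc n}" "c \<in> {col_start b r..<col_start b r + x r}" by (rule UN_E)
  then show thesis by (intro that[of r]) auto
qed

text \<open>Adding a unit at a block inserts one column at the end of that block. The columns common
  to all six minors fall into five stretches, separated by the four insertion points, as in
  \<open>ldet_pluecker_spread\<close>.\<close>

lemma ldet_columns_pluecker:
  fixes V :: "nat \<Rightarrow> nat \<Rightarrow> real" and b x :: "nat \<Rightarrow> nat"
  assumes "i < j" "j < k" "k < l" "l \<le> n"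
  defines "F \<equiv> \<lambda>x. ldet (map V (columns b x 0 (Suc n)))"
  shows "F (x + nunit i + nunit k) * F (x + nunit j + nunit l) =
    F (x + nunit i + nunit j) * F (x + nunit k + nunit l) +
    F (x + nunit i + nunit l) * F (x + nunit j + nunit k)"
proof -
  let ?c = "\<lambda>i. V (col_start b i + x i)" and ?s = "\<lambda>s t. map V (columns b x s t)"
  have parts: "columns b x 0 (Suc j) = columns b x 0 (Suc i) @ columns b x (Suc i) (Suc j)"
      "columns b x 0 (Suc k) = columns b x 0 (Suc i) @ columns b x (Suc i) (Suc j) @ columns b x (Suc j) (Suc k)"
      "columns b x (Suc i) (Suc k) = columns b x (Suc i) (Suc j) @ columns b x (Suc j) (Suc k)"
      "columns b x (Suc j) (Suc l) = columns b x (Suc j) (Suc k) @ columns b x (Suc k) (Suc l)"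
      "columns b x (Suc i) (Suc l) = columns b x (Suc i) (Suc j) @ columns b x (Suc j) (Suc k) @ columns b x (Suc k) (Suc l)"
      "columns b x (Suc k) (Suc n) = columns b x (Suc k) (Suc l) @ columns b x (Suc l) (Suc n)"
      "columns b x (Suc j) (Suc n) = columns b x (Suc j) (Suc k) @ columns b x (Suc k) (Suc l) @ columns b x (Suc l) (Suc n)"
    using assms by (simp_all flip: columns_split)
  show ?thesis
    using ldet_pluecker_spread[of "?s 0 (Suc i)" "?c i" "?s (Suc i) (Suc j)" "?s (Suc j) (Suc k)"
        "?c k" "?s (Suc k) (Suc l)" "?s (Suc l) (Suc n)" "?c j" "?c l"] assms(1-4)
    by (simp add: F_def columns_nunit2 parts del: plus_fun_apply)
qed

text \<open>Columns are numbered from 0, so this is one more than the number of the last column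
  present.\<close>

lemma last_pos_eq:
  assumes "d \<le> n" "0 < x d" "\<And>t. t > d \<Longrightarrow> x t = 0"
  shows "last_pos n b x = col_start b d + x d"
proof -
  have "last_pos n b x = (\<Sum>t\<le>n. if t < d then b t else if t = d then x d else 0)"
    unfolding last_pos_def
  proof (rule sum.cong[OF refl])
    fix t
    show "(if \<exists>s>t. s \<le> n \<and> 0 < x s then b t else x t) = (if t < d then b t else if t = d then x d else 0)"
    proof (cases "t < d")
      case True
      then have "\<exists>s>t. s \<le> n \<and> 0 < x s" using assms by auto
      then show ?thesis using True by simp
    next
      case False
      then have "\<not> (\<exists>s>t. s \<le> n \<and> 0 < x s)" using assms(3) by auto
      then show ?thesis using False assms(3)[of t] by auto
    qed
  qed
  also have "\<dots> = (\<Sum>t\<le>d. if t < d then b t else x d)"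
    using assms(1) by (intro sum.mono_neutral_cong_right) auto
  also have "\<dots> = col_start b d + x d"
    by (simp add: col_start_def flip: lessThan_Suc_atMost)
  finally show ?thesis .
qed

lemma columns_less_last_pos:
  assumes x: "x \<in> slice n b M" and "c \<in> set (columns b x 0 (Suc n))"
  shows "c < last_pos n b x"
proof -
  from assms(2) obtain r where r: "r \<le> n" "c < col_start b r + x r" "col_start b r \<le> c"
    by (rule in_columnsE)
  have "col_start b r + x r = (\<Sum>t\<le>r. if t < r then b t else x t)"
    by (simp add: col_start_def flip: lessThan_Suc_atMost)
  also have "\<dots> \<le> (\<Sum>t\<le>r. if \<exists>s>t. s \<le> n \<and> 0 < x s then b t else x t)"
  proof (rule sum_mono)
    fix t assume "t \<in> {..r}"
    show "(if t < r then b t else x t) \<le> (if \<exists>s>t. s \<le> n \<and> 0 < x s then b t else x t)"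
    proof (cases "t < r")
      case True
      then have "\<exists>s>t. s \<le> n \<and> 0 < x s" using r by auto
      then show ?thesis using True by (simp only: if_True order_refl)
    qed (use \<open>t \<in> {..r}\<close> r(1) x in \<open>auto simp: slice_def\<close>)
  qed
  also have "\<dots> \<le> last_pos n b x"
    unfolding last_pos_def by (rule sum_mono2) (use r(1) in auto)
  finally show ?thesis using r(2) by simp
qed

text \<open>With numbering from 0, the count of columns before the first missing one is also the
  number of that missing column; both readings are used below.\<close>

lemma prefix_len_eq:
  assumes "i \<le> n" "x i < b i" "\<And>s. s < i \<Longrightarrow> x s = b s"
  shows "prefix_len n b x = col_start b i + x i"
proof -
  have "prefix_len n b x = (\<Sum>t\<le>i. x t)"
    unfolding prefix_len_def
    using assms by (intro sum.mono_neutral_cong_right) (auto simp: not_le intro!: exI[of _ i])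
  also have "\<dots> = col_start b i + x i"
    using assms(3) by (simp add: col_start_def flip: lessThan_Suc_atMost)
  finally show ?thesis .
qed

text \<open>Equal sums: an excess in one coordinate must be balanced by a deficit in
  another.\<close>

lemma slice_exchange:
  assumes "x \<in> slice n b M" "y \<in> slice n b M" "x \<noteq> y"
  obtains s t where "s \<le> n" "t \<le> n" "x s < y s" "y t < x t"
proof -
  have "\<exists>s\<le>n. x s < y s" if xy: "x \<in> slice n b M" "y \<in> slice n b M" "x \<noteq> y" for x y
  proof (rule ccontr)
    assume no: "\<not> ?thesis"
    from xy obtain t where t: "x t \<noteq> y t" by auto
    then have "t \<le> n" using xy by (cases "t \<le> n") (auto simp: slice_def)
    then have "sum y {..n} < sum x {..n}"
      using no t by (intro sum_strict_mono_ex1) (auto simp: not_less intro!: bexI[of _ t] le_neq_implies_less)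
    then show False using xy by (simp add: slice_def)
  qed
  from this[of x y] this[of y x] that assms show thesis by metis
qed

text \<open>Distinct vectors differ in opposite directions at two blocks. One of the two is not full
  at the earlier block but occupies the later one. Uniqueness makes the normalising constant of the
  minors well defined.\<close>

lemma is_prefix_unique:
  assumes "x \<in> slice n b M" "y \<in> slice n b M" "is_prefix n b x" "is_prefix n b y"
  shows "x = y"
proof (rule ccontr)
  assume "x \<noteq> y"
  then obtain s t where st: "s \<le> n" "t \<le> n" "x s < y s" "y t < x t"
    using slice_exchange assms by blast
  moreover have "y s \<le> b s" "x t \<le> b t" using st(1,2) assms(1,2) by (auto simp: slice_def)
  ultimately have "x s < b s" "y t < b t" by simp_all
  then show False using st assms by (cases s t rule: linorder_cases) (auto simp: is_prefix_def)
qed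

lemma is_prefixD:
  "is_prefix n b x \<Longrightarrow> x \<in> slice n b M \<Longrightarrow> t < s \<Longrightarrow> s \<le> n \<Longrightarrow> 0 < x s \<Longrightarrow> x t = b t"
  by (rule le_antisym) (auto simp: slice_def is_prefix_def intro: leI)

lemma is_prefix_columns:
  assumes x: "x \<in> slice n b M" "is_prefix n b x"
  shows "columns b x 0 (Suc n) = [0..<M]"
proof -
  have "columns b x 0 t = [0..<sum x {..<t}]" if "t \<le> Suc n" for t
    using that
  proof (induction t)
    case (Suc t)
    have "[0..<sum x {..<t}] @ [col_start b t..<col_start b t + x t] = [0..<sum x {..<t} + x t]"
    proof (cases "x t = 0")
      case False
      have "x s = b s" if "s < t" for s
        using is_prefixD[OF x(2,1) that] False Suc.prems by simp
      then have "col_start b t = sum x {..<t}" by (simp add: col_start_def)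
      then show ?thesis by (simp add: upt_glue)
    qed simp
    then show ?case using Suc by (simp add: columns_def)
  qed (simp add: columns_def)
  from this[of "Suc n"] show ?thesis using x by (simp add: slice_def lessThan_Suc_atMost)
qed

text \<open>\<open>last_pos\<close> is at least the number \<open>M\<close> of columns, with
  equality exactly if none is missing before the last one.\<close>

lemma is_prefix_iff_last_pos:
  assumes x: "x \<in> slice n b M"
  shows "is_prefix n b x \<longleftrightarrow> last_pos n b x \<le> M"
proof -
  have le: "x t \<le> (if \<exists>s>t. s \<le> n \<and> 0 < x s then b t else x t)" if "t \<le> n" for t
    using x that by (simp add: slice_def)
  have M: "M = sum x {..n}" using x by (simp add: slice_def)
  show ?thesis
  proof
    assume p: "is_prefix n b x"
    have "(if \<exists>s>t. s \<le> n \<and> 0 < x s then b t else x t) = x t" if "t \<le> n" for t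
      using is_prefixD[OF p x] by (simp (no_asm_simp)) metis
    then have "last_pos n b x = sum x {..n}" unfolding last_pos_def by (intro sum.cong) auto
    then show "last_pos n b x \<le> M" using M by simp
  next
    assume "last_pos n b x \<le> M"
    show "is_prefix n b x"
    proof (rule ccontr)
      assume "\<not> is_prefix n b x"
      then obtain t s where ts: "t < s" "s \<le> n" "x t < b t" "0 < x s" by (auto simp: is_prefix_def)
      have "sum x {..n} < last_pos n b x" unfolding last_pos_def
        by (rule sum_strict_mono_ex1) (use le ts in \<open>auto intro!: bexI[of _ t]\<close>)
      then show False using M \<open>last_pos n b x \<le> M\<close> by simp
    qed
  qed
qed

lemma add_nunit_slice:
  assumes "z + nunit d \<in> slice n b M" "d \<le> n" "i \<le> n" "z i < b i"
  shows "z + nunit i \<in> slice n b M"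
proof -
  have "sum (z + nunit i) {..n} = M"
    using assms by (simp add: slice_def sum_add_nunit del: plus_fun_apply)
  moreover have "(z + nunit i) t \<le> b t" if "t \<le> n" for t
  proof -
    have "z t + nunit d t \<le> b t" using assms(1) that by (simp add: slice_def)
    then show ?thesis using assms(4) by (simp add: nunit_def)
  qed
  moreover have "(z + nunit i) t = 0" if "t > n" for t
    using assms(1,3) that by (simp add: slice_def nunit_def)
  ultimately show ?thesis by (simp add: slice_def del: plus_fun_apply)
qed

text \<open>A pattern of \<open>z + nunit i\<close> starts at \<open>i\<close> or later, so its
  other indices lie beyond \<open>i\<close> and miss the new unit. Started at \<open>i\<close>, it
  is a pattern of \<open>z + nunit d\<close>, whose extra unit lies beyond \<open>k\<close>.\<close>

lemma gap_free_shift: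
  assumes gf: "gap_free n b (z + nunit d)" and "i < d" "z i < b i" "\<And>s. s < i \<Longrightarrow> z s = b s"
    and "\<And>t. t > d \<Longrightarrow> z t = 0"
  shows "gap_free n b (z + nunit i)"
  unfolding gap_free_def
proof (intro notI, elim exE conjE)
  fix i' c k d' assume pat: "i' < c" "c < k" "k < d'" "d' \<le> n" "(z + nunit i) i' < b i'"
    "0 < (z + nunit i) c" "(z + nunit i) k < b k" "0 < (z + nunit i) d'"
  have "\<not> i' < i" using pat(5) assms(4)[of i'] by (auto simp: nunit_def)
  then have "i < c" "c < k" "k < d'" "i < d'" using pat by auto
  moreover from this pat have "d' \<le> d" using assms(5)[of d'] by (force simp: nunit_def)
  ultimately have "i < c \<and> c < k \<and> k < d' \<and> d' \<le> n \<and> (z + nunit d) i < b i \<and> 0 < (z + nunit d) c \<and>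
      (z + nunit d) k < b k \<and> 0 < (z + nunit d) d'"
    using assms pat by (auto simp: nunit_def)
  then show False using gf unfolding gap_free_def by blast
qed

text \<open>
  The pivots of the triangular system: replacing the last column \<open>N\<close> by the first missing one gives a
  vector that is again free of gaps and was treated before.
\<close>

lemma last_column:
  assumes x: "x \<in> slice n b M" and gf: "gap_free n b x" and last: "last_pos n b x = Suc N" and "M \<le> N"
  obtains z i A B where "columns b x 0 (Suc n) = A @ B @ [N]" "set (A @ B) \<subseteq> {..<N}"
    "Suc (length (A @ B)) = M" "{..<prefix_len n b x} \<subseteq> set (A @ B)" "prefix_len n b x < M"
    "z \<in> slice n b M" "gap_free n b z" "last_pos n b z \<le> N"
    "columns b z 0 (Suc n) = A @ prefix_len n b x # B"
proof -
  have "\<not> is_prefix n b x" using is_prefix_iff_last_pos[OF x] last \<open>M \<le> N\<close> by simp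
  with x obtain i d where id: "i < d" and dn: "d \<le> n" and i: "x i < b i"
    and full: "\<And>s. s < i \<Longrightarrow> x s = b s" and d: "0 < x d" and zero: "\<And>s. s > d \<Longrightarrow> x s = 0"
    by (rule slice_ends) (rule that)
  define z where "z = (\<lambda>t. x t - nunit d t)"
  have zx: "z + nunit d = x" using d by (auto simp: z_def nunit_def)
  have zt: "z t = x t" if "t \<noteq> d" for t using that by (simp add: z_def nunit_def)
  have zd: "x d = Suc (z d)" using zx[symmetric] by (simp add: nunit_def)
  have z_le: "z t \<le> b t" if "t \<le> n" for t using x that by (simp add: slice_def z_def le_diff_conv trans_le_add1)
  have q: "prefix_len n b x = col_start b i + z i"
    using prefix_len_eq[of i n x b] i id dn full zt by simp
  have N: "N = col_start b d + z d" using last_pos_eq[of d n x b] dn d zero last zd by simp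
  have cx: "columns b x 0 (Suc n) = columns b z 0 (Suc n) @ [N]"
  proof -
    have "columns b z (Suc d) (Suc n) = []" using zero zt by (auto simp: columns_def)
    then show ?thesis using columns_nunit[OF dn, of b z] columns_split[of 0 "Suc d" "Suc n" b z] dn
      by (simp add: zx N del: plus_fun_apply)
  qed
  define A where "A = columns b z 0 (Suc i)"
  define B where "B = columns b z (Suc i) (Suc n)"
  have AB: "columns b z 0 (Suc n) = A @ B" unfolding A_def B_def using id dn by (intro columns_split) auto
  have len: "Suc (length (A @ B)) = M"
    using length_columns[of b x n] x unfolding cx AB by (simp add: slice_def)
  have sub: "set (A @ B) \<subseteq> {..<N}"
  proof
    fix c assume "c \<in> set (A @ B)"
    then have "c \<in> set (columns b z 0 (Suc n))" by (simp only: AB)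
    then obtain r where r: "r \<le> n" "c < col_start b r + z r" "col_start b r \<le> c"
      by (rule in_columnsE)
    then have "\<not> d < r" using zero[of r] zt[of r] by auto
    then show "c \<in> {..<N}" using col_start_less[of r d "z r" b] z_le[of r] r N by (cases "r = d") auto
  qed
  \<comment> \<open>All blocks before \<open>i\<close> are full, so the columns up to block
    \<open>i\<close> are exactly the prefix.\<close>
  have pre: "A = [0..<prefix_len n b x]"
  proof -
    have "columns b z 0 t = [0..<col_start b t]" if "t \<le> i" for t
      using that
    proof (induction t)
      case (Suc t)
      then have "z t = b t" using full[of t] zt[of t] id by simp
      with Suc show ?case by (simp add: columns_def col_start_Suc upt_glue)
    qed (simp add: columns_def col_start_def)
    from this[of i] show ?thesis
      unfolding A_def q by (simp add: columns_split[of 0 i "Suc i"]) (simp add: columns_def upt_glue)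
  qed
  have qM: "prefix_len n b x < M" using len pre by simp
  show thesis
  \<comment> \<open>The vector delivered is \<open>z + nunit i\<close>: the local \<open>z\<close>
    has lost column \<open>N\<close>, and block \<open>i\<close> then receives the first missing
    column.\<close>
  proof (rule that)
    show "columns b x 0 (Suc n) = A @ B @ [N]" using cx AB by simp
    show "{..<prefix_len n b x} \<subseteq> set (A @ B)" using pre by auto
    show zi: "z + nunit i \<in> slice n b M"
    proof (rule add_nunit_slice)
      show "z + nunit d \<in> slice n b M" unfolding zx by (rule x)
      show "z i < b i" using i zt[of i] id by simp
    qed (use id dn in simp_all)
    show "gap_free n b (z + nunit i)"
    proof (rule gap_free_shift)
      show "gap_free n b (z + nunit d)" unfolding zx by (rule gf)
      show "z i < b i" using i zt[of i] id by simp
      show "z s = b s" if "s < i" for s using full[OF that] zt[of s] that id by simp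
      show "z s = 0" if "s > d" for s using zero[OF that] zt[of s] that by simp
    qed (rule id)
    have "last_pos n b (z + nunit i) < last_pos n b x"
      by (rule last_pos_less[OF zi dn]) (use id zero zd zt in \<open>simp_all add: nunit_def\<close>)
    then show "last_pos n b (z + nunit i) \<le> N" using last by simp
    show "columns b (z + nunit i) 0 (Suc n) = A @ prefix_len n b x # B"
      using id dn by (simp add: columns_nunit q A_def B_def del: plus_fun_apply)
  qed (use sub len qM in auto)
qed

text \<open>
  Two vectors with the same prefix and the same last column differ only strictly between; where one
  exceeds the other and vice versa, one of them has the forbidden pattern.
\<close>

lemma prefix_len_inj:
  assumes x: "x \<in> slice n b M" "gap_free n b x" "M < last_pos n b x"
    and y: "y \<in> slice n b M" "gap_free n b y"
    and eq: "last_pos n b x = last_pos n b y" "prefix_len n b x = prefix_len n b y"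
  shows "x = y"
proof (rule ccontr)
  assume "x \<noteq> y"
  have "\<not> is_prefix n b x" "\<not> is_prefix n b y"
    using is_prefix_iff_last_pos x(1,3) y(1) eq by auto
  from x(1) this(1) obtain i d where id: "i < d" "d \<le> n" "x i < b i" "0 < x d"
    and full: "\<And>s. s < i \<Longrightarrow> x s = b s" and zero: "\<And>s. s > d \<Longrightarrow> x s = 0"
    by (rule slice_ends) (rule that)
  from y(1) \<open>\<not> is_prefix n b y\<close> obtain i' d' where id': "i' < d'" "d' \<le> n" "y i' < b i'" "0 < y d'"
    and full': "\<And>s. s < i' \<Longrightarrow> y s = b s" and zero': "\<And>s. s > d' \<Longrightarrow> y s = 0"
    by (rule slice_ends) (rule that)
  \<comment> \<open>A column number determines its block and its place there, so equal last columns
    give equal \<open>d\<close> and equal entries; likewise below for the first missing column and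
    \<open>i\<close>.\<close>
  have "col_start b d + x d = col_start b d' + y d'"
    using last_pos_eq[of d n x b] last_pos_eq[of d' n y b] id id' zero zero' eq by simp
  moreover have "x d \<le> b d" "y d' \<le> b d'" using x y id id' by (auto simp: slice_def)
  ultimately have d: "d' = d" "y d = x d"
    using col_start_less[of d d' "x d" b] col_start_less[of d' d "y d'" b] id id'
    by (cases d d' rule: linorder_cases; simp)+
  have "col_start b i + x i = col_start b i' + y i'"
    using prefix_len_eq[of i n x b] prefix_len_eq[of i' n y b] id id' full full' eq by simp
  then have i: "i' = i" "y i = x i"
    using col_start_less[of i i' "Suc (x i)" b] col_start_less[of i' i "Suc (y i')" b] id id'
    by (cases i i' rule: linorder_cases; simp)+
  obtain s t where st: "s \<le> n" "t \<le> n" "x s < y s" "y t < x t"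
    using slice_exchange[OF x(1) y(1) \<open>x \<noteq> y\<close>] by blast
  have "i < r \<and> r < d" if "x r \<noteq> y r" for r
  proof -
    have "r \<noteq> i" "r \<noteq> d" using that d i by auto
    moreover have "\<not> r < i" "\<not> d < r" using that full full' zero zero' d i by auto
    ultimately show ?thesis by simp
  qed
  then have st': "i < s" "s < d" "i < t" "t < d" using st by auto
  have "y s \<le> b s" "x t \<le> b t" using st(1,2) x(1) y(1) by (auto simp: slice_def)
  then have "x s < b s" "y t < b t" using st(3,4) by simp_all
  then consider "t < s" "x s < b s" "0 < x t" | "s < t" "y t < b t" "0 < y s" using st
    by (cases s t rule: linorder_cases) auto
  then show False
  proof cases
    case 1
    then show False using x(2) st' id unfolding gap_free_def by blast
  next
    case 2
    then show False using y(2) st' id i d unfolding gap_free_def by metis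
  qed
qed

text \<open>Equations are solved by decreasing pivot \<open>q x\<close>. Changing \<open>v\<close>
  at \<open>q x\<close> leaves every equation with a larger pivot intact, and injectivity leaves
  only one equation with this pivot.\<close>

lemma triangular_system:
  fixes c :: "'a \<Rightarrow> nat \<Rightarrow> real"
  assumes inj: "inj_on q X" and q: "\<And>x. x \<in> X \<Longrightarrow> q x < M"
    and low: "\<And>x r. x \<in> X \<Longrightarrow> r < q x \<Longrightarrow> c x r = 0"
    and diag: "\<And>x. x \<in> X \<Longrightarrow> c x (q x) \<noteq> 0"
  shows "\<exists>v. \<forall>x\<in>X. (\<Sum>r<M. v r * c x r) = h x"
proof -
  have "\<exists>v. \<forall>x\<in>X. M \<le> q x + k \<longrightarrow> (\<Sum>r<M. v r * c x r) = h x" for k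
  proof (induction k)
    case 0
    show ?case using q by (auto simp: not_le[symmetric])
  next
    case (Suc k)
    then obtain v where v: "\<And>x. x \<in> X \<Longrightarrow> M \<le> q x + k \<Longrightarrow> (\<Sum>r<M. v r * c x r) = h x" by blast
    show ?case
    proof (cases "\<exists>x\<in>X. M = Suc (q x + k)")
      case True
      then obtain x where x: "x \<in> X" "M = Suc (q x + k)" by blast
      \<comment> \<open>The residual of the equation for \<open>x\<close>, divided by its pivot
        entry.\<close>
      define e where "e = (h x - (\<Sum>r<M. v r * c x r)) / c x (q x)"
      define v' where "v' = v(q x := v (q x) + e)"
      have v': "(\<Sum>r<M. v' r * c y r) = (\<Sum>r<M. v r * c y r) + e * c y (q x)" for y
      proof -
        have "(\<Sum>r<M. v' r * c y r) = (\<Sum>r<M. v r * c y r + (if r = q x then e * c y (q x) else 0))"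
          by (intro sum.cong) (auto simp: v'_def algebra_simps)
        then show ?thesis using q[OF x(1)] by (simp add: sum.distrib)
      qed
      have "(\<Sum>r<M. v' r * c y r) = h y" if y: "y \<in> X" "M \<le> q y + Suc k" for y
      proof (cases "q y = q x")
        case True
        then have "y = x" using inj y x by (auto dest: inj_onD)
        then show ?thesis using diag[OF x(1)] by (simp add: v' e_def)
      next
        case False
        then show ?thesis using v[OF y(1)] low[OF y(1), of "q x"] y x(2) unfolding v' by simp
      qed
      then show ?thesis by blast
    next
      case False
      then have "M \<le> q x + k" if "x \<in> X" "M \<le> q x + Suc k" for x using that by force
      then show ?thesis using v by blast
    qed
  qed
  from this[of M] show ?thesis by simp
qed

text \<open>The first \<open>M\<close> columns are unit vectors, so the minor of the prefix vector
  is 1 and \<kappa> adjusts its value. Column \<open>M + N\<close> must realise the values of all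
  gap-free vectors ending there. These are linear equations, whose pivots are, up to sign, minors
  already known to be nonzero.\<close>

lemma columns_exist:
  assumes "\<And>x. x \<in> slice n b M \<Longrightarrow> is_prefix n b x \<Longrightarrow> g x = \<kappa>" "\<kappa> > 0"
    and pos: "\<And>x. x \<in> slice n b M \<Longrightarrow> gap_free n b x \<Longrightarrow> 0 < g x"
  shows "\<exists>V. (\<forall>q<M. V q = basis_col q) \<and> (\<forall>x\<in>slice n b M. gap_free n b x \<longrightarrow> last_pos n b x \<le> M + N \<longrightarrow>
      \<kappa> * ldet (map V (columns b x 0 (Suc n))) = g x)"
proof (induction N)
  case 0
  have "\<kappa> * ldet (map basis_col (columns b x 0 (Suc n))) = g x"
    if "x \<in> slice n b M" "last_pos n b x \<le> M" for x
    using is_prefix_columns[of x n b M] is_prefix_iff_last_pos[of x n b M] that assms(1)[of x]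
    by (simp add: ldet_basis_col)
  then show ?case by (intro exI[of _ basis_col]) auto
next
  case (Suc N)
  then obtain V where V: "\<And>q. q < M \<Longrightarrow> V q = basis_col q"
    "\<And>x. x \<in> slice n b M \<Longrightarrow> gap_free n b x \<Longrightarrow> last_pos n b x \<le> M + N \<Longrightarrow>
      \<kappa> * ldet (map V (columns b x 0 (Suc n))) = g x" by blast
  define X where "X = {x \<in> slice n b M. gap_free n b x \<and> last_pos n b x = Suc (M + N)}"
  \<comment> \<open>The coefficient of entry \<open>r\<close> of the new column in the minor for
    \<open>x\<close>.\<close>
  define c where "c x r = ldet (map V (butlast (columns b x 0 (Suc n))) @ [basis_col r])" for x r
  have "\<exists>v. \<forall>x\<in>X. (\<Sum>r<M. v r * c x r) = g x / \<kappa>"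
  proof (rule triangular_system)
    show "inj_on (prefix_len n b) X"
      by (rule inj_onI, rule prefix_len_inj[of _ n b M]) (auto simp: X_def)
    fix x assume "x \<in> X"
    then have x: "x \<in> slice n b M" "gap_free n b x" "last_pos n b x = Suc (M + N)" by (auto simp: X_def)
    obtain z A B where
      cx: "columns b x 0 (Suc n) = A @ B @ [M + N]" and "set (A @ B) \<subseteq> {..<M + N}"
      and "Suc (length (A @ B)) = M" and pre: "{..<prefix_len n b x} \<subseteq> set (A @ B)"
      and qM: "prefix_len n b x < M"
      and z: "z \<in> slice n b M" "gap_free n b z" "last_pos n b z \<le> M + N"
      and cz: "columns b z 0 (Suc n) = A @ prefix_len n b x # B"
      by (rule last_column[OF x le_add1]) (rule that)
    show "prefix_len n b x < M" by (rule qM)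
    have c: "c x r = ldet (map V (A @ B) @ [basis_col r])" for r
      unfolding c_def cx by (simp add: butlast_append)
    \<comment> \<open>Column \<open>r\<close> is in the prefix of \<open>x\<close> and is the unit
      vector \<open>basis_col r\<close>, so it occurs twice.\<close>
    show "c x r = 0" if "r < prefix_len n b x" for r
    proof -
      have "r \<in> set (A @ B)" using pre that by blast
      then obtain P Q where "A @ B = P @ r # Q" by (meson split_list)
      moreover have "V r = basis_col r" using that qM by (intro V) simp
      ultimately show ?thesis using ldet_dup[of "map V P" "V r" "map V Q" "[]"] by (simp add: c)
    qed
    \<comment> \<open>The first missing column has number below \<open>M\<close>, hence is a unit
      vector too. So the pivot is the minor for \<open>z\<close> with one column moved to the end,
      and that minor is nonzero as \<open>g z\<close> is positive.\<close>
    have "\<kappa> * ldet (map V (A @ prefix_len n b x # B)) = g z" using V(2)[OF z] cz by simp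
    then have "ldet (map V A @ V (prefix_len n b x) # map V B) \<noteq> 0" using pos[OF z(1,2)] by auto
    then show "c x (prefix_len n b x) \<noteq> 0"
      using ldet_move_last[of "map V A" "V (prefix_len n b x)" "map V B"] V(1)[OF qM] by (simp add: c)
  qed
  then obtain v where v: "\<And>x. x \<in> X \<Longrightarrow> (\<Sum>r<M. v r * c x r) = g x / \<kappa>" by blast
  define V' where "V' = V(M + N := v)"
  have "\<kappa> * ldet (map V' (columns b x 0 (Suc n))) = g x"
    if x: "x \<in> slice n b M" "gap_free n b x" "last_pos n b x \<le> M + Suc N" for x
  proof (cases "last_pos n b x \<le> M + N")
    case True
    have "c < M + N" if "c \<in> set (columns b x 0 (Suc n))" for c
      using columns_less_last_pos[OF x(1) that] True by simp
    then have "map V' (columns b x 0 (Suc n)) = map V (columns b x 0 (Suc n))" by (auto simp: V'_def)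
    then show ?thesis using V(2)[OF x(1,2) True] by (simp only:)
  next
    case False
    then have last: "last_pos n b x = Suc (M + N)" using x by simp
    with x have "x \<in> X" by (simp add: X_def)
    obtain A B where
      cx: "columns b x 0 (Suc n) = A @ B @ [M + N]" and AB: "set (A @ B) \<subseteq> {..<M + N}"
      and len: "Suc (length (A @ B)) = M"
      by (rule last_column[OF x(1,2) last le_add1]) (rule that)
    have "map V' (columns b x 0 (Suc n)) = map V (A @ B) @ [v]"
      using AB unfolding cx by (auto simp: V'_def)
    also have "ldet \<dots> = (\<Sum>r<M. v r * ldet (map V (A @ B) @ [basis_col r]))"
      using ldet_expand_last[of "map V (A @ B)" v] unfolding len[symmetric] lessThan_Suc_atMost
      by (simp only: length_map)
    also have "\<dots> = (\<Sum>r<M. v r * c x r)"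
      unfolding c_def cx by (simp add: butlast_append)
    also have "\<dots> = g x / \<kappa>" by (rule v[OF \<open>x \<in> X\<close>])
    finally show ?thesis using \<open>\<kappa> > 0\<close> by simp
  qed
  moreover have "V' q = basis_col q" if "q < M" for q using V(1)[OF that] that by (simp add: V'_def)
  ultimately show ?case by blast
qed

lemma nunit_neq:
  assumes "i < c" "c < k" "k < d"
  shows "z + nunit i + nunit k \<noteq> z + nunit c + nunit d" "z + nunit i + nunit c \<noteq> z + nunit c + nunit d"
    "z + nunit i + nunit d \<noteq> z + nunit c + nunit d" "z + nunit c + nunit k \<noteq> z + nunit c + nunit d"
    "z + nunit k + nunit d \<noteq> z + nunit c + nunit d"
  subgoal using assms by (intro notI, drule_tac fun_cong[of _ _ i], simp add: nunit_def)
  subgoal using assms by (intro notI, drule_tac fun_cong[of _ _ d], simp add: nunit_def)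
  subgoal using assms by (intro notI, drule_tac fun_cong[of _ _ c], simp add: nunit_def)
  subgoal using assms by (intro notI, drule_tac fun_cong[of _ _ d], simp add: nunit_def)
  subgoal using assms by (intro notI, drule_tac fun_cong[of _ _ c], simp add: nunit_def)
  done

text \<open>The relation is homogeneous of degree two, so scaling all minors by \<kappa> preserves
  it. Positivity spreads along \<open>slice_induct\<close>, the relation giving each new value as a
  quotient of positive numbers.\<close>

lemma pluecker_extension:
  assumes pos: "\<And>x. x \<in> slice n b M \<Longrightarrow> gap_free n b x \<Longrightarrow> 0 < (g x :: real)"
  obtains F where "\<And>x. x \<in> slice n b M \<Longrightarrow> gap_free n b x \<Longrightarrow> F x = g x"
    "\<And>x. x \<in> slice n b M \<Longrightarrow> 0 < F x"
    "\<And>z i j k l. i < j \<Longrightarrow> j < k \<Longrightarrow> k < l \<Longrightarrow> l \<le> n \<Longrightarrow>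
      F (z + nunit i + nunit k) * F (z + nunit j + nunit l) =
      F (z + nunit i + nunit j) * F (z + nunit k + nunit l) +
      F (z + nunit i + nunit l) * F (z + nunit j + nunit k)"
proof -
  have gf: "gap_free n b x" if "is_prefix n b x" for x
    using that unfolding gap_free_def is_prefix_def by (metis less_trans less_irrefl)
  \<comment> \<open>The value at the prefix vector, if the slice has one; otherwise 1 is an
    arbitrary positive choice.\<close>
  obtain \<kappa> where \<kappa>: "\<kappa> > 0" "\<And>x. x \<in> slice n b M \<Longrightarrow> is_prefix n b x \<Longrightarrow> g x = \<kappa>"
  proof (cases "\<exists>x\<in>slice n b M. is_prefix n b x")
    case True
    then obtain x where "x \<in> slice n b M" "is_prefix n b x" by blast
    then show thesis using that[of "g x"] pos gf is_prefix_unique by metis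
  next
    case False
    then show thesis using that[of 1] by auto
  qed
  \<comment> \<open>No \<open>last_pos\<close> exceeds the total number \<open>sum b {..n}\<close>
    of columns, so this \<open>N\<close> covers all gap-free vectors.\<close>
  from columns_exist[where N = "sum b {..n}" and g = g and n = n and b = b and M = M, OF \<kappa>(2,1) pos]
  obtain V where V: "\<And>x. x \<in> slice n b M \<Longrightarrow> gap_free n b x \<Longrightarrow> last_pos n b x \<le> M + sum b {..n} \<Longrightarrow>
      \<kappa> * ldet (map V (columns b x 0 (Suc n))) = g x" by blast
  define F where "F x = \<kappa> * ldet (map V (columns b x 0 (Suc n)))" for x
  have F_eq: "F x = g x" if x: "x \<in> slice n b M" "gap_free n b x" for x
  proof -
    have "last_pos n b x \<le> sum b {..n}"
      unfolding last_pos_def using x(1) by (intro sum_mono) (auto simp: slice_def)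
    then show ?thesis unfolding F_def by (intro V[OF x]) simp
  qed
  have F_pl: "F (z + nunit i + nunit k) * F (z + nunit j + nunit l) =
      F (z + nunit i + nunit j) * F (z + nunit k + nunit l) +
      F (z + nunit i + nunit l) * F (z + nunit j + nunit k)"
    if "i < j" "j < k" "k < l" "l \<le> n" for z i j k l
    using arg_cong[OF ldet_columns_pluecker[OF that, of V b z], of "\<lambda>u. \<kappa> * \<kappa> * u"]
    by (simp only: F_def distrib_left mult_ac)
  have "0 < F x" if "x \<in> slice n b M" for x
    using that
  proof (induction rule: slice_induct)
    case (base x)
    then show ?case using pos F_eq by simp
  next
    case (step z i c k d)
    have IH: "0 < F y" if "y \<noteq> z + nunit c + nunit d" "y \<in> quad z i c k d" for y
      using step.IH that by blast
    have "0 < F (z + nunit i + nunit k)" "0 < F (z + nunit i + nunit c) * F (z + nunit k + nunit d)"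
      "0 < F (z + nunit i + nunit d) * F (z + nunit c + nunit k)"
      by (intro mult_pos_pos IH nunit_neq[OF step.hyps(1-3)]; simp add: quad_def)+
    then show ?case using F_pl[OF step.hyps(1-4), of z] by (metis add_pos_pos zero_less_mult_pos)
  qed
  then show thesis using that F_eq F_pl by blast
qed

section \<open>Tropical limit\<close>

text \<open>The scaled logarithm lies between the maximum and the maximum plus
  \<open>ln 2 / real (Suc p)\<close>. Using \<open>Suc p\<close> avoids a zero scale.\<close>

lemma log_sum_exp_tendsto_max:
  fixes u v :: "nat \<Rightarrow> real"
  assumes "u \<longlonglongrightarrow> U" "v \<longlonglongrightarrow> V"
  shows "(\<lambda>p. ln (exp (real (Suc p) * u p) + exp (real (Suc p) * v p)) / real (Suc p)) \<longlonglongrightarrow> max U V"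
proof (rule tendsto_sandwich)
  show "(\<lambda>p. max (u p) (v p)) \<longlonglongrightarrow> max U V" using assms by (intro tendsto_max)
  have "(\<lambda>p. max (u p) (v p) + ln 2 * inverse (real (Suc p))) \<longlonglongrightarrow> max U V + ln 2 * 0"
    using assms LIMSEQ_inverse_real_of_nat by (intro tendsto_intros)
  then show "(\<lambda>p. max (u p) (v p) + ln 2 / real (Suc p)) \<longlonglongrightarrow> max U V" by (simp add: divide_inverse)
  have *: "max (u p) (v p) \<le> ln (exp (real (Suc p) * u p) + exp (real (Suc p) * v p)) / real (Suc p) \<and>
    ln (exp (real (Suc p) * u p) + exp (real (Suc p) * v p)) / real (Suc p) \<le> max (u p) (v p) + ln 2 / real (Suc p)" for p
  proof -
    define r where "r = real (Suc p)"
    define m where "m = max (u p) (v p)"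
    have r: "r > 0" by (simp add: r_def)
    have le: "exp (r * u p) \<le> exp (r * m)" "exp (r * v p) \<le> exp (r * m)"
      using r by (auto simp: m_def)
    have "exp (r * m) \<le> exp (r * u p) + exp (r * v p)" by (simp add: m_def max_def add_increasing add_increasing2)
    moreover have "exp (r * u p) + exp (r * v p) \<le> exp (ln 2 + r * m)" using add_mono[OF le] by (simp add: exp_add)
    ultimately have "ln (exp (r * m)) \<le> ln (exp (r * u p) + exp (r * v p))"
      "ln (exp (r * u p) + exp (r * v p)) \<le> ln (exp (ln 2 + r * m))"
      by (subst ln_le_cancel_iff; simp add: add_pos_pos)+
    then have "r * m \<le> ln (exp (r * u p) + exp (r * v p))" "ln (exp (r * u p) + exp (r * v p)) \<le> ln 2 + r * m"
      by (simp_all only: ln_exp)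
    then show ?thesis using r unfolding r_def[symmetric] m_def[symmetric]
      by (simp add: field_simps)
  qed
  then show "\<forall>\<^sub>F p in sequentially. max (u p) (v p) \<le> ln (exp (real (Suc p) * u p) + exp (real (Suc p) * v p)) / real (Suc p)"
    "\<forall>\<^sub>F p in sequentially. ln (exp (real (Suc p) * u p) + exp (real (Suc p) * v p)) / real (Suc p) \<le> max (u p) (v p) + ln 2 / real (Suc p)"
    by simp_all
qed

section \<open>Tropical Pluecker functions on a slice: uniqueness and existence\<close>

definition tropical_pluecker :: "nat \<Rightarrow> (nat \<Rightarrow> nat) set \<Rightarrow> ((nat \<Rightarrow> nat) \<Rightarrow> real) \<Rightarrow> bool" where
  "tropical_pluecker n S f \<longleftrightarrow> (\<forall>z i j k l. i < j \<longrightarrow> j < k \<longrightarrow> k < l \<longrightarrow> l \<le> n \<longrightarrow> quad z i j k l \<subseteq> S \<longrightarrow>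
     f (z + nunit i + nunit k) + f (z + nunit j + nunit l) =
       max (f (z + nunit i + nunit j) + f (z + nunit k + nunit l))
           (f (z + nunit i + nunit l) + f (z + nunit j + nunit k)))"

lemma tropical_pluecker_unique:
  assumes f: "tropical_pluecker n (slice n b M) f" and f': "tropical_pluecker n (slice n b M) f'"
    and eq: "\<And>x. x \<in> slice n b M \<Longrightarrow> gap_free n b x \<Longrightarrow> f x = f' x"
    and "x \<in> slice n b M"
  shows "f x = f' x"
  using assms(4)
proof (induction rule: slice_induct)
  case (step z i c k d)
  have IH: "f y = f' y" if "y \<noteq> z + nunit c + nunit d" "y \<in> quad z i c k d" for y
    using step.IH that by blast
  show ?case
    using f[unfolded tropical_pluecker_def, rule_format, OF step.hyps]
      f'[unfolded tropical_pluecker_def, rule_format, OF step.hyps]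
      IH[OF nunit_neq(1)[OF step.hyps(1-3)]] IH[OF nunit_neq(2)[OF step.hyps(1-3)]] IH[OF nunit_neq(3)[OF step.hyps(1-3)]]
      IH[OF nunit_neq(4)[OF step.hyps(1-3)]] IH[OF nunit_neq(5)[OF step.hyps(1-3)]]
    by (simp add: quad_def del: plus_fun_apply)
qed (rule eq)

text \<open>The scaled logarithms do not depend on \<open>p\<close> at gap-free vectors. Convergence
  elsewhere follows by \<open>slice_induct\<close>, since the relation writes the new sequence as a
  log-sum-exp expression minus a convergent sequence. The limits then satisfy the tropical
  relation.\<close>

lemma tropical_pluecker_extension:
  obtains f where "tropical_pluecker n (slice n b M) f"
    "\<And>x. x \<in> slice n b M \<Longrightarrow> gap_free n b x \<Longrightarrow> f x = g x"
proof -
  let ?S = "slice n b M"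
  have "\<exists>F. (\<forall>x\<in>?S. gap_free n b x \<longrightarrow> F x = exp (real (Suc p) * g x)) \<and> (\<forall>x\<in>?S. 0 < F x) \<and>
    (\<forall>z i j k l. i < j \<longrightarrow> j < k \<longrightarrow> k < l \<longrightarrow> l \<le> n \<longrightarrow>
      F (z + nunit i + nunit k) * F (z + nunit j + nunit l) =
      F (z + nunit i + nunit j) * F (z + nunit k + nunit l) +
      F (z + nunit i + nunit l) * F (z + nunit j + nunit k))" for p
    by (rule pluecker_extension[of n b M "\<lambda>x. exp (real (Suc p) * g x)"]) (simp, blast)
  then obtain F where F_eq: "\<And>p x. x \<in> ?S \<Longrightarrow> gap_free n b x \<Longrightarrow> F p x = exp (real (Suc p) * g x)"
    and F_pos: "\<And>p x. x \<in> ?S \<Longrightarrow> 0 < F p x"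
    and F_pl: "\<And>p z i j k l. i < j \<Longrightarrow> j < k \<Longrightarrow> k < l \<Longrightarrow> l \<le> n \<Longrightarrow>
      F p (z + nunit i + nunit k) * F p (z + nunit j + nunit l) =
      F p (z + nunit i + nunit j) * F p (z + nunit k + nunit l) +
      F p (z + nunit i + nunit l) * F p (z + nunit j + nunit k)" by metis
  define h where "h p x = ln (F p x) / real (Suc p)" for p x
  have F_h: "F p x = exp (real (Suc p) * h p x)" if "x \<in> ?S" for p x
    using F_pos[OF that] by (simp add: h_def)
  have h_pl: "h p (z + nunit i + nunit k) + h p (z + nunit j + nunit l) =
      ln (exp (real (Suc p) * (h p (z + nunit i + nunit j) + h p (z + nunit k + nunit l))) +
          exp (real (Suc p) * (h p (z + nunit i + nunit l) + h p (z + nunit j + nunit k)))) / real (Suc p)"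
    if lt: "i < j" "j < k" "k < l" "l \<le> n" and S: "quad z i j k l \<subseteq> ?S" for p z i j k l
  proof -
    have "exp (real (Suc p) * (h p (z + nunit i + nunit k) + h p (z + nunit j + nunit l))) =
      exp (real (Suc p) * (h p (z + nunit i + nunit j) + h p (z + nunit k + nunit l))) +
      exp (real (Suc p) * (h p (z + nunit i + nunit l) + h p (z + nunit j + nunit k)))"
      using F_pl[OF lt, of p z] S unfolding quad_def by (simp only: F_h insert_subset distrib_left exp_add)
    then show ?thesis by (metis ln_exp nonzero_mult_div_cancel_left of_nat_0_eq_iff nat.distinct(2))
  qed
  have conv: "convergent (\<lambda>p. h p x)" if "x \<in> ?S" for x
    using that
  proof (induction rule: slice_induct)
    case (base x)
    then have "h p x = g x" for p by (simp add: h_def F_eq)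
    then show ?case by (simp add: convergent_const)
  next
    case (step z i c k d)
    have IH: "(\<lambda>p. h p y) \<longlonglongrightarrow> lim (\<lambda>p. h p y)" if "y \<noteq> z + nunit c + nunit d" "y \<in> quad z i c k d" for y
      using step.IH that by (simp add: convergent_LIMSEQ_iff)
    have IH': "(\<lambda>p. h p (z + nunit i + nunit k)) \<longlonglongrightarrow> lim (\<lambda>p. h p (z + nunit i + nunit k))"
      "(\<lambda>p. h p (z + nunit i + nunit c)) \<longlonglongrightarrow> lim (\<lambda>p. h p (z + nunit i + nunit c))"
      "(\<lambda>p. h p (z + nunit k + nunit d)) \<longlonglongrightarrow> lim (\<lambda>p. h p (z + nunit k + nunit d))"
      "(\<lambda>p. h p (z + nunit i + nunit d)) \<longlonglongrightarrow> lim (\<lambda>p. h p (z + nunit i + nunit d))"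
      "(\<lambda>p. h p (z + nunit c + nunit k)) \<longlonglongrightarrow> lim (\<lambda>p. h p (z + nunit c + nunit k))"
      by (intro IH nunit_neq[OF step.hyps(1-3)], simp add: quad_def)+
    from tendsto_diff[OF log_sum_exp_tendsto_max[OF tendsto_add[OF IH'(2,3)] tendsto_add[OF IH'(4,5)]] IH'(1)]
    show ?case unfolding h_pl[OF step.hyps, symmetric] by (simp add: convergentI del: plus_fun_apply)
  qed
  define f where "f x = lim (\<lambda>p. h p x)" for x
  have lim: "(\<lambda>p. h p x) \<longlonglongrightarrow> f x" if "x \<in> ?S" for x
    using conv[OF that] by (simp add: f_def convergent_LIMSEQ_iff)
  show thesis
  proof (rule that[of f])
    show "tropical_pluecker n ?S f" unfolding tropical_pluecker_def
    proof (intro allI impI)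
      fix z i j k l assume lt: "i < j" "j < k" "k < l" "l \<le> n" and S: "quad z i j k l \<subseteq> ?S"
      let ?r = "\<lambda>p. h p (z + nunit i + nunit k) + h p (z + nunit j + nunit l)"
      have S': "z + nunit i + nunit k \<in> ?S" "z + nunit j + nunit l \<in> ?S" "z + nunit i + nunit j \<in> ?S"
        "z + nunit k + nunit l \<in> ?S" "z + nunit i + nunit l \<in> ?S" "z + nunit j + nunit k \<in> ?S"
        using S by (simp_all only: quad_def insert_subset)
      have "?r \<longlonglongrightarrow> f (z + nunit i + nunit k) + f (z + nunit j + nunit l)"
        by (intro tendsto_add lim S')
      moreover have "?r \<longlonglongrightarrow> max (f (z + nunit i + nunit j) + f (z + nunit k + nunit l))
           (f (z + nunit i + nunit l) + f (z + nunit j + nunit k))"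
        unfolding h_pl[OF lt S] by (intro log_sum_exp_tendsto_max tendsto_add lim S')
      ultimately show "f (z + nunit i + nunit k) + f (z + nunit j + nunit l) =
          max (f (z + nunit i + nunit j) + f (z + nunit k + nunit l))
           (f (z + nunit i + nunit l) + f (z + nunit j + nunit k))"
        by (rule LIMSEQ_unique)
    qed
    show "f x = g x" if x: "x \<in> ?S" "gap_free n b x" for x
    proof -
      have "h p x = g x" for p using x by (simp add: h_def F_eq)
      then show ?thesis using lim[OF x(1)] by (simp add: LIMSEQ_const_iff)
    qed
  qed
qed

section \<open>Fuzzy-intervals and sesquialteral fuzzy-intervals\<close>

lemma box_nonneg: "x \<in> box n a \<Longrightarrow> 0 \<le> x t"
  by (cases "t \<in> {1..n}") (auto simp: box_def int_vecs_def)

lemma box_le: "x \<in> box n a \<Longrightarrow> t \<in> {1..n} \<Longrightarrow> x t \<le> a t"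
  by (auto simp: box_def)

lemma box_support: "x \<in> box n a \<Longrightarrow> x t \<noteq> 0 \<Longrightarrow> t \<in> {1..n}"
  unfolding box_def int_vecs_def by blast

lemma box_vsupp_iff: "x \<in> box n a \<Longrightarrow> t \<in> vsupp n x \<longleftrightarrow> 0 < x t"
  using box_nonneg[of x n a t] by (auto simp: vsupp_def box_def int_vecs_def)

lemma box_vsupp_ends:
  assumes "x \<in> box n a" "x \<noteq> 0"
  shows "0 < x (cmin n x)" "0 < x (dmax n x)" "cmin n x \<in> {1..n}" "dmax n x \<in> {1..n}"
    and "\<And>t. 0 < x t \<Longrightarrow> cmin n x \<le> t \<and> t \<le> dmax n x"
proof -
  have fin: "finite (vsupp n x)" by (simp add: vsupp_def)
  obtain t where "x t \<noteq> 0" using assms(2) by (auto simp: fun_eq_iff)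
  then have "t \<in> vsupp n x" using box_support[OF assms(1)] by (simp add: vsupp_def)
  then have "vsupp n x \<noteq> {}" by blast
  then have in_supp: "cmin n x \<in> vsupp n x" "dmax n x \<in> vsupp n x"
    unfolding cmin_def dmax_def using fin by (auto intro: Min_in Max_in)
  then show "0 < x (cmin n x)" "0 < x (dmax n x)" using box_vsupp_iff[OF assms(1)] by auto
  show "cmin n x \<in> {1..n}" "dmax n x \<in> {1..n}" using in_supp by (auto simp: vsupp_def)
  show "cmin n x \<le> t \<and> t \<le> dmax n x" if "0 < x t" for t
    unfolding cmin_def dmax_def using that box_vsupp_iff[OF assms(1)] fin by (auto intro: Min_le Max_ge)
qed

text \<open>The ends of the support can be replaced by any two of its points; this form compares
  directly with \<open>gap_free\<close>.\<close>

lemma fint_iff: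
  assumes x: "x \<in> box n a" "x \<noteq> 0"
  shows "fint n a x \<longleftrightarrow> \<not> (\<exists>c k d. c < k \<and> k < d \<and> 0 < x c \<and> x k < a k \<and> 0 < x d)"
proof
  assume f: "fint n a x"
  show "\<not> (\<exists>c k d. c < k \<and> k < d \<and> 0 < x c \<and> x k < a k \<and> 0 < x d)"
  proof (intro notI, elim exE conjE)
    fix c k d assume "c < k" "k < d" "0 < x c" "x k < a k" "0 < x d"
    then have "cmin n x < k" "k < dmax n x"
      using box_vsupp_ends(5)[OF x, of c] box_vsupp_ends(5)[OF x, of d] by simp_all
    then show False using f \<open>x k < a k\<close> by (simp add: fint_def)
  qed
next
  assume no: "\<not> (\<exists>c k d. c < k \<and> k < d \<and> 0 < x c \<and> x k < a k \<and> 0 < x d)"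
  have "x i = a i" if "cmin n x < i" "i < dmax n x" for i
  proof -
    have "\<not> x i < a i" using no that box_vsupp_ends(1,2)[OF x] by blast
    moreover have "x i \<le> a i" using box_vsupp_ends(3,4)[OF x] that by (intro box_le[OF x(1)]) auto
    ultimately show ?thesis by simp
  qed
  then show "fint n a x" using x by (simp add: fint_def)
qed

text \<open>In a sesquialteral vector, an \<open>i\<close> that is not full is at least
  \<open>dmax n x'\<close>, so \<open>c\<close>, \<open>k\<close>, \<open>d\<close> lie in
  \<open>x''\<close>, which is a fuzzy-interval. Conversely, a vector without the pattern is cut
  after its first coordinate that is not full.\<close>

lemma fint_or_sint_iff:
  assumes x: "x \<in> box n a" "x \<noteq> 0"
  shows "fint n a x \<or> sint n a x \<longleftrightarrow>
    \<not> (\<exists>i c k d. 1 \<le> i \<and> i < c \<and> c < k \<and> k < d \<and> x i < a i \<and> 0 < x c \<and> x k < a k \<and> 0 < x d)"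
    (is "_ \<longleftrightarrow> \<not> ?pattern")
proof
  assume "fint n a x \<or> sint n a x"
  then show "\<not> ?pattern"
  proof
    assume "fint n a x"
    then show ?thesis unfolding fint_iff[OF x] by blast
  next
    assume "sint n a x"
    then obtain x' x'' where f: "fint n a x'" "fint n a x''" and xx: "x = x' + x''"
      and full: "\<And>i. 1 \<le> i \<Longrightarrow> i < dmax n x' \<Longrightarrow> x' i = a i"
      unfolding sint_def by blast
    have x': "x' \<in> box n a" "x' \<noteq> 0" and x'': "x'' \<in> box n a" "x'' \<noteq> 0"
      using f by (auto simp: fint_def)
    show ?thesis
    proof (intro notI, elim exE conjE)
      fix i c k d assume pat: "1 \<le> i" "i < c" "c < k" "k < d" "x i < a i" "0 < x c" "x k < a k" "0 < x d"
      have "\<not> i < dmax n x'"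
        using full[OF pat(1)] pat(5) box_nonneg[OF x''(1), of i] by (auto simp: xx)
      then have "x' t = 0" if "i < t" for t
        using that box_vsupp_ends(5)[OF x', of t] box_nonneg[OF x'(1), of t] \<open>\<not> i < dmax n x'\<close>
        by linarith
      then have "0 < x'' c" "x'' k < a k" "0 < x'' d" using pat by (auto simp: xx)
      then show False using f(2) pat(3,4) unfolding fint_iff[OF x''] by blast
    qed
  qed
next
  assume no: "\<not> ?pattern"
  show "fint n a x \<or> sint n a x"
  proof (cases "fint n a x")
    case False
    then obtain c k d where pat: "c < k" "k < d" "0 < x c" "x k < a k" "0 < x d"
      unfolding fint_iff[OF x] by blast
    have "c \<in> {1..n}" "d \<in> {1..n}" 
      using pat(3,5) box_support[OF x(1), of c] box_support[OF x(1), of d] by simp_all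
    define i where "i = (LEAST i. 1 \<le> i \<and> x i < a i)"
    have k: "1 \<le> k \<and> x k < a k" using pat by auto
    have i: "1 \<le> i" "x i < a i" "i \<le> k" unfolding i_def 
      using LeastI[of "\<lambda>i. 1 \<le> i \<and> x i < a i", OF k] Least_le[of "\<lambda>i. 1 \<le> i \<and> x i < a i", OF k] by auto
    have full: "x t = a t" if "1 \<le> t" "t < i" for t
    proof -
      have "\<not> x t < a t" using not_less_Least[of t "\<lambda>i. 1 \<le> i \<and> x i < a i"] that by (auto simp: i_def)
      moreover have "x t \<le> a t" using that i pat \<open>d \<in> {1..n}\<close> by (intro box_le[OF x(1)]) auto
      ultimately show ?thesis by simp
    qed
    \<comment> \<open>Otherwise \<open>i\<close> would complete the pattern. Hence \<open>c\<close>
      and \<open>d\<close> lie on different sides of the cut, and neither part is zero.\<close>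
    have "c \<le> i"
    proof (rule ccontr)
      assume "\<not> c \<le> i"
      then have "i < c" by simp
      with i(1,2) pat no show False by blast
    qed
    define x' where "x' = (\<lambda>t. if t \<le> i then x t else 0)"
    define x'' where "x'' = (\<lambda>t. if t \<le> i then 0 else x t)"
    have "0 \<le> a t" if "t \<in> {1..n}" for t 
      using box_nonneg[OF x(1), of t] box_le[OF x(1) that] by simp
    then have box': "x' \<in> box n a" and box'': "x'' \<in> box n a"
      using x(1) by (auto simp: box_def int_vecs_def x'_def x''_def)
    have "0 < x' c" "0 < x'' d" using pat i \<open>c \<le> i\<close> by (auto simp: x'_def x''_def)
    then have ne: "x' \<noteq> 0" "x'' \<noteq> 0" by auto
    have "dmax n x' \<le> i" using box_vsupp_ends(2)[OF box' ne(1)] by (auto simp: x'_def split: if_splits)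
    have "i < cmin n x''" using box_vsupp_ends(1)[OF box'' ne(2)] by (auto simp: x''_def split: if_splits)
    have "fint n a x'"
      unfolding fint_iff[OF box' ne(1)]
    proof (intro notI, elim exE conjE)
      fix c k d assume p: "c < k" "k < d" "0 < x' c" "x' k < a k" "0 < x' d"
      then have "d \<le> i" by (auto simp: x'_def split: if_splits)
      then show False using p full[of k] by (simp add: x'_def)
    qed
    moreover have "fint n a x''"
      unfolding fint_iff[OF box'' ne(2)]
    proof (intro notI, elim exE conjE)
      fix c k d assume p: "c < k" "k < d" "0 < x'' c" "x'' k < a k" "0 < x'' d"
      then have "i < c" "0 < x c" by (auto simp: x''_def split: if_splits)
      moreover from this p have "x k < a k" "0 < x d" by (auto simp: x''_def split: if_splits)
      ultimately show False using no i(1,2) p(1,2) by blast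
    qed
    moreover have "x = x' + x''" by (auto simp: x'_def x''_def)
    moreover have "x' t = a t" if "1 \<le> t" "t < dmax n x'" for t
      using full[of t] that \<open>dmax n x' \<le> i\<close> by (simp add: x'_def)
    ultimately have "sint n a x"
      unfolding sint_def using x False le_less_trans[OF \<open>dmax n x' \<le> i\<close> \<open>i < cmin n x''\<close>]
      by (intro conjI exI[of _ x'] exI[of _ x'']) simp_all
    then show ?thesis ..
  qed simp
qed

section \<open>The extra coordinate\<close>

lemma vsize_add_unit_vec: "i \<in> {1..n} \<Longrightarrow> vsize n (x + unit_vec i) = vsize n x + 1"
  unfolding vsize_def plus_fun_apply sum.distrib by (simp add: unit_vec_def)

text \<open>The coordinate \<open>0\<close>, unused by the vectors of \<open>int_vecs n\<close>, serves as the extra one.\<close>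

definition ext_bound :: "(nat \<Rightarrow> int) \<Rightarrow> int \<Rightarrow> int \<Rightarrow> nat \<Rightarrow> nat" where
  "ext_bound a m m' = (\<lambda>t. nat (if t = 0 then m' - m else a t))"

definition extend :: "int \<Rightarrow> (nat \<Rightarrow> int) \<Rightarrow> nat \<Rightarrow> nat" where
  "extend s x = (\<lambda>t. nat (if t = 0 then s else x t))"

definition drop_zero :: "nat \<Rightarrow> (nat \<Rightarrow> nat) \<Rightarrow> nat \<Rightarrow> int" where
  "drop_zero n y = (\<lambda>t. if t \<in> {1..n} then int (y t) else 0)"

lemma drop_zero_in_int_vecs: "drop_zero n y \<in> int_vecs n"
  by (simp add: drop_zero_def int_vecs_def)

lemma drop_zero_nunit:
  "drop_zero n (y + nunit 0) = drop_zero n y"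
  "i \<in> {1..n} \<Longrightarrow> drop_zero n (y + nunit i) = drop_zero n y + unit_vec i"
  by (auto simp: drop_zero_def nunit_def unit_vec_def)

text \<open>The nonnegativity assumptions keep \<open>nat\<close> from truncating, so that it
  commutes with adding one.\<close>

lemma extend_unit_vec:
  "0 \<le> s \<Longrightarrow> extend (s + 1) x = extend s x + nunit 0"
  "1 \<le> i \<Longrightarrow> 0 \<le> x i \<Longrightarrow> extend s (x + unit_vec i) = extend s x + nunit i"
  by (auto simp: extend_def nunit_def unit_vec_def nat_add_distrib)

lemma sum_atMost_0: "(\<Sum>t\<le>n. f t) = f 0 + (\<Sum>t\<in>{1..n}. f t)" for f :: "nat \<Rightarrow> 'a::comm_monoid_add"
  by (simp add: sum.atMost_shift sum.shift_bounds_cl_Suc_ivl atLeast1_atMost_eq_remove0 sum.remove[of _ 0] atMost_atLeast0)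

section \<open>Transfer between the truncated box and the slice\<close>

locale box_params =
  fixes n :: nat and a :: "nat \<Rightarrow> int" and m m' :: int
  assumes a_pos: "\<forall>i\<in>{1..n}. a i > 0" and m_le: "0 \<le> m" "m \<le> m'"
begin

abbreviation "B \<equiv> truncated_box n a m m'"
abbreviation "b \<equiv> ext_bound a m m'"
abbreviation "S \<equiv> slice n b (nat m')"
abbreviation "lift x \<equiv> extend (m' - vsize n x) x"

lemma in_B: "x \<in> B \<longleftrightarrow> x \<in> box n a \<and> m \<le> vsize n x \<and> vsize n x \<le> m'"
  by (simp add: truncated_box_def)

lemma lift_in_S: "x \<in> B \<Longrightarrow> lift x \<in> S"
proof -
  assume x: "x \<in> B"
  then have xb: "x \<in> box n a" by (simp add: in_B)
  have "int (\<Sum>t\<in>{1..n}. nat (x t)) = vsize n x"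
    using box_nonneg[OF xb] by (simp add: vsize_def)
  then have "(\<Sum>t\<in>{1..n}. nat (x t)) = nat (vsize n x)" by (metis nat_int)
  then have "sum (lift x) {..n} = nat (m' - vsize n x) + nat (vsize n x)"
    by (simp add: sum_atMost_0 extend_def)
  also have "\<dots> = nat m'" using x m_le by (simp add: in_B flip: nat_add_distrib)
  finally have "sum (lift x) {..n} = nat m'" .
  moreover have "lift x t = 0" if "t > n" for t
    using xb that by (simp add: extend_def box_def int_vecs_def)
  moreover have "lift x t \<le> b t" if "t \<le> n" for t
    using x box_le[OF xb, of t] that by (auto simp: extend_def ext_bound_def in_B intro!: nat_mono)
  ultimately show ?thesis by (simp add: slice_def)
qed

lemma vsize_drop_zero: "y \<in> S \<Longrightarrow> vsize n (drop_zero n y) = m' - int (y 0)"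
proof -
  assume "y \<in> S"
  then have "y 0 + (\<Sum>t\<in>{1..n}. y t) = nat m'" by (simp add: slice_def sum_atMost_0)
  then have "int (y 0) + (\<Sum>t\<in>{1..n}. int (y t)) = m'" using m_le by (simp flip: of_nat_sum of_nat_add)
  then show ?thesis by (simp add: vsize_def drop_zero_def)
qed

lemma drop_zero_in_B: "y \<in> S \<Longrightarrow> drop_zero n y \<in> B"
proof -
  assume y: "y \<in> S"
  have le: "int (y t) \<le> int (b t)" if "t \<le> n" for t using y that by (simp add: slice_def)
  have "int (y 0) \<le> m' - m" using le[of 0] m_le by (simp add: ext_bound_def)
  moreover have "int (y t) \<le> a t" if "t \<in> {1..n}" for t
  proof -
    have "0 < a t" using a_pos that by blast
    then show ?thesis using le[of t] that by (simp add: ext_bound_def split: if_splits)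
  qed
  ultimately show ?thesis
    using vsize_drop_zero[OF y] drop_zero_in_int_vecs[of n y] by (auto simp: in_B box_def drop_zero_def)
qed

lemma lift_drop_zero: "y \<in> S \<Longrightarrow> lift (drop_zero n y) = y"
  unfolding vsize_drop_zero by (auto simp: extend_def drop_zero_def slice_def fun_eq_iff)

lemma drop_zero_lift: "x \<in> B \<Longrightarrow> drop_zero n (lift x) = x"
proof (rule ext)
  fix t assume "x \<in> B"
  then have x: "x \<in> box n a" by (simp add: in_B)
  show "drop_zero n (lift x) t = x t"
    using box_nonneg[OF x, of t] box_support[OF x, of t]
    by (cases "t \<in> {1..n}") (auto simp: extend_def drop_zero_def)
qed

text \<open>For \<open>i = 0\<close>, \<open>drop_zero\<close> forgets the unit at 0, so three of
  the six vectors carry a single unit and the relation is (TP3) for \<open>j\<close>,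
  \<open>k\<close>, \<open>l\<close>. Otherwise it is (TP4).\<close>

lemma tropical_pluecker_lift:
  assumes "TP3 n B f" "TP4 n B f"
  shows "tropical_pluecker n S (f \<circ> drop_zero n)"
  unfolding tropical_pluecker_def
proof (intro allI impI)
  fix z i j k l assume lt: "i < j" "j < k" "k < l" "l \<le> n" and quad: "quad z i j k l \<subseteq> S"
  have in_B: "drop_zero n ` quad z i j k l \<subseteq> B" using quad drop_zero_in_B by blast
  let ?x = "drop_zero n z"
  note dz = drop_zero_nunit drop_zero_in_int_vecs
  show "(f \<circ> drop_zero n) (z + nunit i + nunit k) + (f \<circ> drop_zero n) (z + nunit j + nunit l) =
       max ((f \<circ> drop_zero n) (z + nunit i + nunit j) + (f \<circ> drop_zero n) (z + nunit k + nunit l))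
           ((f \<circ> drop_zero n) (z + nunit i + nunit l) + (f \<circ> drop_zero n) (z + nunit j + nunit k))"
  proof (cases "i = 0")
    case True
    have "{?x + unit_vec j + unit_vec l, ?x + unit_vec k, ?x + unit_vec j + unit_vec k,
        ?x + unit_vec l, ?x + unit_vec j, ?x + unit_vec k + unit_vec l} \<subseteq> B"
      using in_B lt True by (simp add: quad_def dz del: plus_fun_apply)
    then have *: "f (?x + unit_vec j + unit_vec l) + f (?x + unit_vec k) =
        max (f (?x + unit_vec j + unit_vec k) + f (?x + unit_vec l))
            (f (?x + unit_vec j) + f (?x + unit_vec k + unit_vec l))"
      using lt True by (intro assms(1)[unfolded TP3_def, rule_format, OF dz(3)]) simp_all
    have drop: "drop_zero n (z + nunit 0 + nunit q) = ?x + unit_vec q"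
      "drop_zero n (z + nunit p + nunit q) = ?x + unit_vec p + unit_vec q"
      if "p \<in> {1..n}" "q \<in> {1..n}" for p q
      using that by (simp_all only: dz)
    have "j \<in> {1..n}" "k \<in> {1..n}" "l \<in> {1..n}" using lt True by simp_all
    then show ?thesis unfolding True o_apply using * by (simp only: drop)
  next
    case False
    have "{?x + unit_vec i + unit_vec k, ?x + unit_vec j + unit_vec l,
        ?x + unit_vec i + unit_vec j, ?x + unit_vec k + unit_vec l,
        ?x + unit_vec i + unit_vec l, ?x + unit_vec j + unit_vec k} \<subseteq> B"
      using in_B lt False by (simp add: quad_def dz del: plus_fun_apply)
    then show ?thesis
      using assms(2)[unfolded TP4_def, rule_format, OF dz(3), of i j k l z] lt False
      by (simp add: dz del: plus_fun_apply)
  qed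
qed

text \<open>Each added unit lowers the extra coordinate by one; the base vector has it at its value
  after both additions.\<close>

lemma lift_add_unit_vec2:
  assumes "p \<in> {1..n}" "q \<in> {1..n}" "p \<noteq> q" "0 \<le> x p" "0 \<le> x q"
  shows "lift (x + unit_vec p + unit_vec q) = extend (m' - vsize n x - 2) x + nunit p + nunit q"
proof -
  have "(x + unit_vec p) q = x q" using assms(3) by (simp add: unit_vec_def)
  then have "extend s (x + unit_vec p + unit_vec q) = extend s x + nunit p + nunit q" for s
    using assms by (simp only: extend_unit_vec atLeastAtMost_iff)
  moreover have "m' - vsize n (x + unit_vec p + unit_vec q) = m' - vsize n x - 2"
    using assms by (simp only: vsize_add_unit_vec)
  ultimately show ?thesis by (simp only:)
qed

lemma TP_of_tropical_pluecker:
  assumes "tropical_pluecker n S F" and f: "\<And>x. x \<in> B \<Longrightarrow> f x = F (lift x)"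
  shows "TP3 n B f" "TP4 n B f"
proof -
  show "TP3 n B f" unfolding TP3_def
  proof (intro ballI allI impI)
    fix x i j k
    assume lt: "1 \<le> i \<and> i < j \<and> j < k \<and> k \<le> n"
      and "{x + unit_vec i + unit_vec k, x + unit_vec j,
        x + unit_vec i + unit_vec j, x + unit_vec k,
        x + unit_vec i, x + unit_vec j + unit_vec k} \<subseteq> B"
    then have inB: "x + unit_vec i + unit_vec k \<in> B" "x + unit_vec j \<in> B"
      "x + unit_vec i + unit_vec j \<in> B" "x + unit_vec k \<in> B"
      "x + unit_vec i \<in> B" "x + unit_vec j + unit_vec k \<in> B" by simp_all
    define s where "s = m' - vsize n x - 2"
    let ?z = "extend s x"
    have s: "0 \<le> s" using inB(1) lt by (simp add: in_B vsize_add_unit_vec s_def del: plus_fun_apply)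
    \<comment> \<open>\<open>x\<close> itself is not assumed to lie in the box, so each entry is
      read off from one of the six vectors that has no unit at that index.\<close>
    have nonneg: "0 \<le> x i" "0 \<le> x j" "0 \<le> x k"
      using inB(2,5) lt box_nonneg[of "x + unit_vec j" n a i] box_nonneg[of "x + unit_vec j" n a k]
        box_nonneg[of "x + unit_vec i" n a j] by (auto simp: in_B unit_vec_def)
    \<comment> \<open>With a single unit added, the extra coordinate is \<open>s + 1\<close>: the
      missing second unit sits at index 0.\<close>
    have single: "lift (x + unit_vec p) = ?z + nunit 0 + nunit p" if "p \<in> {1..n}" "0 \<le> x p" for p
    proof -
      have "m' - vsize n (x + unit_vec p) = s + 1"
        using that by (simp add: vsize_add_unit_vec s_def del: plus_fun_apply)
      moreover have "extend (s + 1) (x + unit_vec p) = extend s x + nunit 0 + nunit p"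
        using that s by (simp only: extend_unit_vec atLeastAtMost_iff)
      ultimately show ?thesis by (simp only:)
    qed
    have *: "lift (x + unit_vec i + unit_vec k) = ?z + nunit i + nunit k"
      "lift (x + unit_vec j) = ?z + nunit 0 + nunit j"
      "lift (x + unit_vec i + unit_vec j) = ?z + nunit i + nunit j"
      "lift (x + unit_vec k) = ?z + nunit 0 + nunit k"
      "lift (x + unit_vec i) = ?z + nunit 0 + nunit i"
      "lift (x + unit_vec j + unit_vec k) = ?z + nunit j + nunit k"
      using lt nonneg by (simp_all add: lift_add_unit_vec2 single s_def del: plus_fun_apply)
    have "quad ?z 0 i j k \<subseteq> S"
      unfolding quad_def *[symmetric] using inB lift_in_S by simp
    then have "F (?z + nunit 0 + nunit j) + F (?z + nunit i + nunit k) =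
       max (F (?z + nunit 0 + nunit i) + F (?z + nunit j + nunit k))
           (F (?z + nunit 0 + nunit k) + F (?z + nunit i + nunit j))"
      using lt by (intro assms(1)[unfolded tropical_pluecker_def, rule_format]) simp_all
    then show "f (x + unit_vec i + unit_vec k) + f (x + unit_vec j) =
       max (f (x + unit_vec i + unit_vec j) + f (x + unit_vec k))
           (f (x + unit_vec i) + f (x + unit_vec j + unit_vec k))"
      unfolding inB[THEN f] * by (simp add: add.commute max.commute)
  qed
  show "TP4 n B f" unfolding TP4_def
  proof (intro ballI allI impI)
    fix x i j k l
    assume lt: "1 \<le> i \<and> i < j \<and> j < k \<and> k < l \<and> l \<le> n"
      and "{x + unit_vec i + unit_vec k, x + unit_vec j + unit_vec l,
        x + unit_vec i + unit_vec j, x + unit_vec k + unit_vec l,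
        x + unit_vec i + unit_vec l, x + unit_vec j + unit_vec k} \<subseteq> B"
    then have inB: "x + unit_vec i + unit_vec k \<in> B" "x + unit_vec j + unit_vec l \<in> B"
        "x + unit_vec i + unit_vec j \<in> B" "x + unit_vec k + unit_vec l \<in> B"
        "x + unit_vec i + unit_vec l \<in> B" "x + unit_vec j + unit_vec k \<in> B" by simp_all
    let ?z = "extend (m' - vsize n x - 2) x"
    have nonneg: "0 \<le> x i" "0 \<le> x j" "0 \<le> x k" "0 \<le> x l"
      using inB(3,4) lt box_nonneg[of "x + unit_vec k + unit_vec l" n a i]
        box_nonneg[of "x + unit_vec k + unit_vec l" n a j]
        box_nonneg[of "x + unit_vec i + unit_vec j" n a k]
        box_nonneg[of "x + unit_vec i + unit_vec j" n a l]
      by (auto simp: in_B unit_vec_def)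
    have *: "lift (x + unit_vec i + unit_vec k) = ?z + nunit i + nunit k"
      "lift (x + unit_vec j + unit_vec l) = ?z + nunit j + nunit l"
      "lift (x + unit_vec i + unit_vec j) = ?z + nunit i + nunit j"
      "lift (x + unit_vec k + unit_vec l) = ?z + nunit k + nunit l"
      "lift (x + unit_vec i + unit_vec l) = ?z + nunit i + nunit l"
      "lift (x + unit_vec j + unit_vec k) = ?z + nunit j + nunit k"
      using lt nonneg by (simp_all add: lift_add_unit_vec2 del: plus_fun_apply)
    have "quad ?z i j k l \<subseteq> S"
      unfolding quad_def *[symmetric] using inB lift_in_S by simp
    then show "f (x + unit_vec i + unit_vec k) + f (x + unit_vec j + unit_vec l) =
       max (f (x + unit_vec i + unit_vec j) + f (x + unit_vec k + unit_vec l))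
           (f (x + unit_vec i + unit_vec l) + f (x + unit_vec j + unit_vec k))"
      using assms(1) lt unfolding tropical_pluecker_def inB[THEN f] * by blast
  qed
qed

text \<open>Coordinate 0 is below its bound exactly if \<open>m < vsize n x\<close>. Then
  \<open>i = 0\<close> is always available and only fuzzy-intervals avoid the pattern. On the bottom
  level \<open>i\<close> must be positive, which also admits the sesquialteral ones.\<close>

lemma gap_free_lift_iff:
  assumes x: "x \<in> B"
  shows "gap_free n b (lift x) \<longleftrightarrow> x \<in> std_basis n a m m'"
proof (cases "x = 0")
  case True
  then have "gap_free n b (lift x)" by (auto simp: gap_free_def extend_def)
  moreover have "m = 0" using x True m_le by (auto simp: in_B vsize_def)
  ultimately show ?thesis using True by (simp add: std_basis_def)
next
  case False
  have xb: "x \<in> box n a" using x by (simp add: in_B)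
  note fint = fint_iff[OF xb False] and fint_or_sint = fint_or_sint_iff[OF xb False]
  have lt_b: "lift x t < b t \<longleftrightarrow> (if t = 0 then m < vsize n x else x t < a t)" for t
    using x box_nonneg[OF xb, of t] by (auto simp: extend_def ext_bound_def in_B nat_less_eq_zless)
  have pos: "0 < lift x t \<longleftrightarrow> 0 < x t" if "0 < t" for t using that by (simp add: extend_def)
  have le_n: "t \<le> n" if "0 < x t" for t using box_support[OF xb, of t] that by simp
  have "gap_free n b (lift x) \<longleftrightarrow>
    \<not> (\<exists>i c k d. i < c \<and> c < k \<and> k < d \<and> (if i = 0 then m < vsize n x else x i < a i) \<and> 0 < x c \<and> x k < a k \<and> 0 < x d)"
    unfolding gap_free_def lt_b
    by (intro arg_cong[where f = Not] ex_cong1) (auto simp: pos le_n)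
  also have "\<dots> \<longleftrightarrow> fint n a x \<or> m = vsize n x \<and> sint n a x"
  proof (cases "m = vsize n x")
    case True
    then have "(\<exists>i c k d. i < c \<and> c < k \<and> k < d \<and> (if i = 0 then m < vsize n x else x i < a i) \<and> 0 < x c \<and> x k < a k \<and> 0 < x d)
      \<longleftrightarrow> (\<exists>i c k d. 1 \<le> i \<and> i < c \<and> c < k \<and> k < d \<and> x i < a i \<and> 0 < x c \<and> x k < a k \<and> 0 < x d)"
      by (intro ex_cong1) auto
    then show ?thesis using fint_or_sint True by simp
  next
    case neq: False
    then have "m < vsize n x" using x by (simp add: in_B)
    have "(\<exists>i c k d. i < c \<and> c < k \<and> k < d \<and> (if i = 0 then m < vsize n x else x i < a i) \<and> 0 < x c \<and> x k < a k \<and> 0 < x d)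
      \<longleftrightarrow> (\<exists>c k d. c < k \<and> k < d \<and> 0 < x c \<and> x k < a k \<and> 0 < x d)" (is "?l \<longleftrightarrow> ?r")
    proof
      assume ?r
      then obtain c k d where p: "c < k" "k < d" "0 < x c" "x k < a k" "0 < x d" by blast
      then have "0 < c" using box_support[OF xb, of c] by simp
      then show ?l using p \<open>m < vsize n x\<close> by (intro exI[of _ 0] exI[of _ c] exI[of _ k] exI[of _ d]) simp
    qed blast
    then show ?thesis using fint neq by simp
  qed
  also have "\<dots> \<longleftrightarrow> x \<in> std_basis n a m m'"
    using x False by (auto simp: std_basis_def Fints_def Sints_def in_B)
  finally show ?thesis .
qed

lemma std_basis_subset: "std_basis n a m m' \<subseteq> B"
proof
  fix x assume "x \<in> std_basis n a m m'"
  then consider "x \<in> box n a" "m \<le> vsize n x" "vsize n x \<le> m'" | "x = 0" "m = 0"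
    using m_le by (auto simp: std_basis_def Fints_def Sints_def fint_def sint_def split: if_splits)
  then show "x \<in> B"
  proof cases
    case 2
    have "(0 :: nat \<Rightarrow> int) \<in> box n a" using a_pos by (auto simp: box_def int_vecs_def less_imp_le)
    then show ?thesis using 2 m_le by (simp add: truncated_box_def vsize_def)
  qed (simp add: in_B)
qed

text \<open>Injectivity is uniqueness on the slice and surjectivity is existence there, both carried
  over by the mutually inverse maps \<open>lift\<close> and \<open>drop_zero n\<close>.\<close>

lemma TP_basis_std: "TP_basis n B (std_basis n a m m')"
  unfolding TP_basis_def
proof (intro conjI std_basis_subset)
  let ?C = "std_basis n a m m'"
  show "bij_betw (\<lambda>f. restrict f ?C) (TP_functions n B) (?C \<rightarrow>\<^sub>E UNIV)"
  proof (rule bij_betwI')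
    fix f f' assume f: "f \<in> TP_functions n B" and f': "f' \<in> TP_functions n B"
    show "restrict f ?C = restrict f' ?C \<longleftrightarrow> f = f'"
    proof
      assume eq: "restrict f ?C = restrict f' ?C"
      have trop: "tropical_pluecker n S (f \<circ> drop_zero n)" "tropical_pluecker n S (f' \<circ> drop_zero n)"
        using f f' by (auto intro!: tropical_pluecker_lift simp: TP_functions_def)
      have agree: "(f \<circ> drop_zero n) y = (f' \<circ> drop_zero n) y" if y: "y \<in> S" "gap_free n b y" for y
      proof -
        have "drop_zero n y \<in> ?C"
          using gap_free_lift_iff[OF drop_zero_in_B[OF y(1)]] lift_drop_zero[OF y(1)] y(2) by simp
        then show ?thesis using fun_cong[OF eq, of "drop_zero n y"] by simp
      qed
      have on_S: "(f \<circ> drop_zero n) y = (f' \<circ> drop_zero n) y" if "y \<in> S" for y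
        by (rule tropical_pluecker_unique[OF trop agree that])
      have on_B: "f x = f' x" if "x \<in> B" for x
        using on_S[OF lift_in_S[OF that]] drop_zero_lift[OF that] by simp
      show "f = f'"
        by (rule PiE_ext[of _ B "\<lambda>_. UNIV"]) (use f f' on_B in \<open>auto simp: TP_functions_def\<close>)
    qed simp
  next
    fix f assume "f \<in> TP_functions n B"
    show "restrict f ?C \<in> ?C \<rightarrow>\<^sub>E UNIV" by auto
  next
    fix g :: "(nat \<Rightarrow> int) \<Rightarrow> real" assume g: "g \<in> ?C \<rightarrow>\<^sub>E UNIV"
    obtain F where F: "tropical_pluecker n S F"
      "\<And>y. y \<in> S \<Longrightarrow> gap_free n b y \<Longrightarrow> F y = g (drop_zero n y)"
      using tropical_pluecker_extension[of n b "nat m'" "\<lambda>y. g (drop_zero n y)"] by blast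
    define f where "f = restrict (\<lambda>x. F (lift x)) B"
    have fx: "f x = F (lift x)" if "x \<in> B" for x using that by (simp add: f_def)
    have "f \<in> TP_functions n B"
      using TP_of_tropical_pluecker[OF F(1) fx] by (simp add: TP_functions_def) (simp add: f_def)
    moreover have "restrict f ?C = g"
    proof (rule PiE_ext[of _ ?C "\<lambda>_. UNIV"])
      fix x assume x: "x \<in> ?C"
      then have xB: "x \<in> B" using std_basis_subset by blast
      then have "gap_free n b (lift x)" using gap_free_lift_iff x by simp
      then show "restrict f ?C x = g x"
        using F(2)[OF lift_in_S[OF xB]] x by (simp add: fx[OF xB] drop_zero_lift[OF xB])
    qed (use g in auto)
    ultimately show "\<exists>f\<in>TP_functions n B. g = restrict f ?C" by blast
  qed
qed

end

theorem theoremA: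
  fixes n :: nat and a :: "nat \<Rightarrow> int" and m m' :: int
  assumes "n \<ge> 1"
    and "\<forall>i\<in>{1..n}. a i > 0"
    and "0 \<le> m" and "m \<le> m'" and "m' \<le> vsize n a"
  shows "TP_basis n (truncated_box n a m m') (std_basis n a m m')"
proof -
  interpret box_params n a m m' using assms(2-4) by unfold_locales
  show ?thesis by (rule TP_basis_std)
qed

end
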